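(* Let $p$ be a prime. For every $a,b,c,d,k\in \mathbb{N}_0$ with $k\le a+b+c+d$ we have $$N(p^a,p^b,p^c,p^d;p^k)= \sum \varphi(p^{x_3})\, \varphi(p^{y_3})\, \varphi(p^{z_3})\, \varphi(p^{t_3})\, F(p^u,p^v),$$ where the sum is over all 20-tuples $$(x_1,x_2,x_3,x_4,x_5,\,y_1,y_2,y_3,y_4,y_5,\,z_1,z_2,z_3,z_4,z_5,\,t_1,t_2,t_3,t_4,t_5)\in \mathbb{N}_0^{20}$$ satisfying the following 11 conditions, of which (ix) and (x) also define $u$ and $v$: (i) $x_1+x_2+x_3=a$; (ii) $x_3+x_4+x_5=b$; (iii) $y_1+y_2+y_3=\min(x_1,x_4)$; (iv) $y_3+y_4+y_5=x_3+\max(x_1,x_4)$; (v) $z_1+z_2+z_3=c$; (vi) $z_3+z_4+z_5=d$; (vii) $t_1+t_2+t_3=\min(z_1,z_4)$; (viii) $t_3+t_4+t_5=z_3+\max(z_1,z_4)$; (ix) $\min(y_2,y_5)=\min(t_2,t_5)=:u$; (x) $y_3+\max(y_2,y_5)= t_3+ \max(t_2,t_5)=:v$; (xi) $x_1+x_3+x_4+t_1+t_3+t_4=k$.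
   Context: $\mathbb{N}=\{1,2,\ldots\}$ and $\mathbb{N}_0=\mathbb{N}\cup\{0\}$. $\mathbb{Z}_n$ denotes the additive group of residue classes modulo $n$. For $m,n,r,s,k\in\mathbb{N}$ with $k\mid mnrs$, $N(m,n,r,s;k)$ denotes the number of subgroups of order $k$ of the group $\mathbb{Z}_m\times\mathbb{Z}_n\times\mathbb{Z}_r\times\mathbb{Z}_s$. $\varphi$ is Euler's totient function. For $m,n\in\mathbb{N}$, $F(m,n)$ denotes the number of automorphisms of the group $\mathbb{Z}_m\times\mathbb{Z}_n$. *)

theory Defs
  imports "HOL-Algebra.Elementary_Groups" "HOL-Algebra.Bij" "HOL-Number_Theory.Totient"
begin

(* integer_mod_group n is the group of residues modulo n for n > 0; for n = 0 it is the
   infinite cyclic group, so both counts below are meant for positive moduli only. *)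

definition N :: "nat \<Rightarrow> nat \<Rightarrow> nat \<Rightarrow> nat \<Rightarrow> nat \<Rightarrow> nat" where
  "N m n r s k =
     card {H. subgroup H (integer_mod_group m \<times>\<times> integer_mod_group n \<times>\<times>
                          integer_mod_group r \<times>\<times> integer_mod_group s) \<and>
              card H = k}"

(* auto G consists of extensional functions, so each automorphism is counted once. *)

definition F :: "nat \<Rightarrow> nat \<Rightarrow> nat" where
  "F m n = card (auto (integer_mod_group m \<times>\<times> integer_mod_group n))"

end

theory Submission
  imports Defs "HOL-Algebra.Multiplicative_Group"
begin

text \<open>
  By Goursat's lemma a subgroup \<open>K\<close> of \<open>G \<times> H\<close> amounts to chains \<open>B \<le> A \<le> G\<close> and \<open>D \<le> C \<le> H\<close>
  together with an isomorphism \<open>A/B \<cong> C/D\<close>, and \<open>|K| = |A| |D|\<close>. Apply it to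
  \<open>G = Z(p^a) \<times> Z(p^b)\<close> and \<open>H = Z(p^c) \<times> Z(p^d)\<close>: the number of isomorphisms \<open>A/B \<cong> C/D\<close>
  is \<open>F(p^u, p^v)\<close> if both quotients are isomorphic to \<open>Z(p^u) \<times> Z(p^v)\<close>, and \<open>0\<close> if their types
  differ.

  To count the chains of each type, apply Goursat's lemma again, first to the subgroups \<open>A\<close> of
  \<open>G\<close> and then to the subgroups \<open>B\<close> of \<open>A\<close>, which is itself of the form \<open>Z(p^m) \<times> Z(p^n)\<close>. Here
  the two factors are cyclic, so the chains are given by their orders and the number of
  isomorphisms is a totient. A subgroup or quotient of a product of two cyclic \<open>p\<close>-groups is
  generated by two elements, so its type is determined by its order and its exponent, and both
  can be read off the Goursat data.
\<close>

subsection \<open>Counting isomorphisms\<close>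

text \<open>The subgroup \<open>A\<close> in which Goursat's lemma is applied a second time is only
  isomorphic to a product of residue groups, not equal to one. Hence counts and types are
  established in \<open>Z (p ^ a) \<times>\<times> Z (p ^ b)\<close> and then carried to every
  abelian group isomorphic to it. The isomorphism is chosen anew for each \<open>A\<close>; this is
  harmless, because the facts extracted about orders, types and class sizes hold for every choice.
  The exponent of a group of rank at most two gives its larger cyclic factor, and the order then
  gives the smaller one. This is the origin of the entries with \<open>min\<close> and of those that
  add \<open>max\<close> to a middle component: in (iii), (iv), (vii), (viii) they are types of
  subgroups, in (ix), (x) types of quotients. The formula for the order treats the two sides
  differently: it takes the large group \<open>A\<close> of the first chain and the small group
  \<open>D\<close> of the second. Therefore (xi) combines the quintuple x, which describes
  \<open>A\<close> in the first product, with the quintuple t, which describes \<open>D\<close> in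
  \<open>C\<close>.\<close>

definition isos :: "('a, 'c) monoid_scheme \<Rightarrow> ('b, 'd) monoid_scheme \<Rightarrow> ('a \<Rightarrow> 'b) set" where
  "isos G H = iso G H \<inter> extensional (carrier G)"

text \<open>Restricting to extensional functions, as \<open>auto\<close> does, identifies maps that
  agree on the carrier. Without this \<open>card\<close> would not count each isomorphism
  once.\<close>

lemma auto_eq_isos: "auto G = isos G G"
  by (auto simp: auto_def isos_def iso_def Bij_def)

lemma finite_isos:
  assumes "finite (carrier G)" "finite (carrier H)"
  shows "finite (isos G H)"
  by (rule finite_subset [OF _ finite_PiE [OF assms(1), of "\<lambda>_. carrier H"]])
    (auto simp: isos_def iso_def hom_def PiE_def assms)

lemma isos_eq_empty:
  assumes "group G" "\<not> G \<cong> H"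
  shows "isos G H = {}"
  using assms by (auto simp: isos_def is_iso_def)

text \<open>Conjugating \<open>h\<close> with isomorphisms \<open>f\<close> and \<open>g\<close> to
  \<open>g \<circ> h \<circ> f'\<close>, where \<open>f'\<close> inverts \<open>f\<close>, is
  injective. One inequality suffices, since the two sides can exchange roles.\<close>

lemma card_isos_le:
  assumes G: "group G" "G \<cong> G'" "H \<cong> H'" and fin: "finite (isos G' H')"
    and G': "group G'"
  shows "card (isos G H) \<le> card (isos G' H')"
proof -
  obtain f g where f: "f \<in> iso G G'" and g: "g \<in> iso H H'"
    using G by (auto simp: is_iso_def)
  define f' where "f' = inv_into (carrier G) f"
  have f': "f' \<in> iso G' G"
    unfolding f'_def by (rule group.iso_set_sym [OF G(1) f])
  have bf: "bij_betw f' (carrier G') (carrier G)"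
    using f' by (simp add: iso_def)
  have bg: "bij_betw g (carrier H) (carrier H')"
    using g by (simp add: iso_def)
  define T where "T h = restrict (g \<circ> h \<circ> f') (carrier G')" for h
  have "T h \<in> isos G' H'" if "h \<in> isos G H" for h
  proof -
    have "h \<in> iso G H"
      using that by (simp add: isos_def)
    then have "g \<circ> (h \<circ> f') \<in> iso G' H'"
      by (intro iso_set_trans [OF _ g] iso_set_trans [OF f'])
    then show ?thesis
      unfolding isos_def T_def using G'
      by (auto simp: o_assoc intro: group.iso_eq)
  qed
  moreover have "inj_on T (isos G H)"
  proof (rule inj_onI)
    fix h h' assume h: "h \<in> isos G H" "h' \<in> isos G H" and eq: "T h = T h'"
    show "h = h'"
    proof (rule extensionalityI [of _ "carrier G"])
      fix x assume "x \<in> carrier G"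
      then obtain y where y: "y \<in> carrier G'" "x = f' y"
        using bf by (auto simp: bij_betw_def)
      have "g (h x) = g (h' x)"
        using fun_cong [OF eq, of y] y by (simp add: T_def)
      moreover have "h x \<in> carrier H" "h' x \<in> carrier H"
        using h \<open>x \<in> carrier G\<close> by (auto simp: isos_def iso_def hom_def)
      ultimately show "h x = h' x"
        using bg by (auto simp: bij_betw_def inj_on_def)
    qed (use h in \<open>auto simp: isos_def\<close>)
  qed
  ultimately show ?thesis
    by (intro card_inj_on_le [of T] fin) auto
qed

lemma card_isos_cong:
  assumes "group G" "group H" "group G'" "group H'" "G \<cong> G'" "H \<cong> H'"
    and "finite (carrier G)" "finite (carrier H)"
  shows "card (isos G H) = card (isos G' H')"
proof (rule antisym)
  have "finite (carrier G')" "finite (carrier H')"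
    using assms iso_finite by blast+
  then show "card (isos G H) \<le> card (isos G' H')"
    using assms by (intro card_isos_le finite_isos)
  show "card (isos G' H') \<le> card (isos G H)"
    using assms by (intro card_isos_le finite_isos) (auto intro: group.iso_sym)
qed

subsection \<open>Cyclic groups\<close>

abbreviation Z :: "nat \<Rightarrow> int monoid" where "Z \<equiv> integer_mod_group"

lemma carrier_Z: "n > 0 \<Longrightarrow> carrier (Z n) = {0..<int n}"
  by (simp add: carrier_integer_mod_group)

lemma finite_Z: "n > 0 \<Longrightarrow> finite (carrier (Z n))"
  by (simp add: carrier_Z)

lemma card_Z: "n > 0 \<Longrightarrow> card (carrier (Z n)) = n"
  by (simp add: carrier_Z)

text \<open>Addition in \<open>Z n\<close> reduces modulo \<open>n\<close>; this makes the power map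
  \<open>i \<mapsto> x [^] i\<close> compatible with it, so that it is a homomorphism on
  \<open>Z n\<close>.\<close>

lemma (in group) int_pow_mod:
  assumes "x \<in> carrier G" "x [^] n = \<one>"
  shows "x [^] (i mod int n) = x [^] (i::int)"
proof -
  have "ord x dvd n"
    using assms pow_eq_id by blast
  moreover have "int n dvd i mod int n - i"
    by (simp add: mod_eq_dvd_iff [symmetric])
  ultimately have "int (ord x) dvd i mod int n - i"
    by (metis dvd_trans of_nat_dvd_iff)
  then show ?thesis
    using assms(1) by (subst int_pow_eq) (auto simp: mod_eq_dvd_iff dvd_diff_commute)
qed

lemma card_isos_Z:
  assumes "n > 0"
  shows "card (isos (Z n) (Z n)) = totient n"
\<comment> \<open>For \<open>n = 1\<close> the residue 1 is not in the carrier, whereas below an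
  automorphism is identified by its value at 1.\<close>
proof (cases "n = 1")
  case True
  have "isos (Z 1) (Z 1) = {\<lambda>x\<in>{0}. 0}"
  proof -
    have "f = (\<lambda>x\<in>{0}. 0)" if "f \<in> isos (Z 1) (Z 1)" for f
      using that by (auto simp: isos_def iso_def hom_def carrier_integer_mod_group extensional_def fun_eq_iff)
    moreover have "(\<lambda>x\<in>{0}. 0) \<in> isos (Z 1) (Z 1)"
      by (auto simp: isos_def iso_def hom_def carrier_integer_mod_group bij_betw_def inj_on_def)
    ultimately show ?thesis by blast
  qed
  then show ?thesis using True by simp
next
  case False
  then have n: "n > 1" using assms by simp
  \<comment> \<open>The automorphisms of \<open>Z n\<close> are the multiplications by units;
    \<open>\<mu> k\<close> is multiplication by \<open>k\<close>.\<close>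
  define \<mu> where "\<mu> k = (\<lambda>x\<in>carrier (Z n). int k * x mod int n)" for k
  have "bij_betw \<mu> (totatives n) (isos (Z n) (Z n))"
  proof (rule bij_betw_imageI)
    show "inj_on \<mu> (totatives n)"
    proof (rule inj_onI)
      fix k l assume kl: "k \<in> totatives n" "l \<in> totatives n" "\<mu> k = \<mu> l"
      have "int k mod int n = int l mod int n"
        using fun_cong [OF kl(3), of 1] n by (auto simp: \<mu>_def carrier_Z)
      then show "k = l"
        using totatives_less [OF kl(1) n] totatives_less [OF kl(2) n] by simp
    qed
    have "\<mu> k \<in> isos (Z n) (Z n)" if k: "k \<in> totatives n" for k
    proof -
      have "coprime (int k) (int n)"
        using k by (simp add: in_totatives_iff)
      have inj: "inj_on (\<mu> k) (carrier (Z n))"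
      proof (rule inj_onI)
        fix x y assume xy: "x \<in> carrier (Z n)" "y \<in> carrier (Z n)" "\<mu> k x = \<mu> k y"
        then have "[int k * x = int k * y] (mod int n)"
          by (simp add: \<mu>_def cong_def)
        then have "[x = y] (mod int n)"
          using \<open>coprime (int k) (int n)\<close> cong_mult_lcancel by blast
        then show "x = y"
          using xy n by (simp add: carrier_Z cong_def)
      qed
      have sub: "\<mu> k ` carrier (Z n) \<subseteq> carrier (Z n)"
        using n by (auto simp: \<mu>_def carrier_Z)
      have "\<mu> k ` carrier (Z n) = carrier (Z n)"
        using endo_inj_surj [OF finite_Z sub inj] n by simp
      moreover have "\<mu> k \<in> hom (Z n) (Z n)"
        using n by (auto simp: \<mu>_def hom_def carrier_Z mod_simps distrib_left)
      ultimately show ?thesis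
        using inj by (auto simp: isos_def iso_def bij_betw_def \<mu>_def)
    qed
    moreover have "f \<in> \<mu> ` totatives n" if f: "f \<in> isos (Z n) (Z n)" for f
    proof -
      have hom: "f \<in> hom (Z n) (Z n)" and bij: "bij_betw f (carrier (Z n)) (carrier (Z n))"
        and ext: "f \<in> extensional (carrier (Z n))"
        using f by (auto simp: isos_def iso_def)
      have "f 1 \<in> {0..<int n}"
        using hom n by (auto simp: hom_def carrier_Z)
      then obtain k where k: "f 1 = int k" "k < n"
        by (metis atLeastLessThan_iff nonneg_int_cases of_nat_less_iff)
      have f: "f x = int k * x mod int n" if "x \<in> carrier (Z n)" for x
      proof -
        have "1 [^]\<^bsub>Z n\<^esub> nat x = x"
          using that n by (simp add: carrier_Z)
        then have "f x = f 1 [^]\<^bsub>Z n\<^esub> nat x"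
          using group_hom.hom_nat_pow [of "Z n" "Z n" f 1 "nat x"] hom n
          by (simp add: group_hom_def group_hom_axioms_def)
        then show ?thesis
          using that n k by (simp add: carrier_Z mult.commute)
      qed
      \<comment> \<open>A preimage of 1 under \<open>f\<close> is an inverse of \<open>k\<close>
        modulo \<open>n\<close>, so surjectivity alone makes \<open>k\<close> a unit.\<close>
      have "1 \<in> f ` carrier (Z n)"
        using bij n by (simp add: bij_betw_def)
      then obtain x where "x \<in> carrier (Z n)" "int k * x mod int n = 1"
        using f by auto
      then have "[int k * x = 1] (mod int n)"
        using n by (simp add: cong_def)
      then have "coprime (int k) (int n)"
        using coprime_iff_invertible_int by blast
      then have "k \<in> totatives n"
        using k n by (auto simp: in_totatives_iff intro!: Nat.gr0I)
      moreover have "f = \<mu> k"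
        using f ext by (auto simp: \<mu>_def extensional_def fun_eq_iff)
      ultimately show ?thesis by blast
    qed
    ultimately show "\<mu> ` totatives n = isos (Z n) (Z n)" by blast
  qed
  then show ?thesis
    by (simp add: bij_betw_same_card totient_def)
qed

lemma (in group) cyclic_group_iso_Z:
  assumes "cyclic_group G" "finite (carrier G)" and n: "card (carrier G) = n"
  shows "G \<cong> Z n"
proof -
  obtain g where g: "g \<in> carrier G" "carrier G = range (\<lambda>i::int. g [^] i)"
    using assms cyclic_group by auto
  have "n > 0"
    using assms g card_gt_0_iff by blast
  have gn: "g [^] n = \<one>"
    using pow_order_eq_1 [OF g(1)] n by (simp add: order_def)
  define f where "f = (\<lambda>i::int. g [^] i)"
  have red: "g [^] (i mod int n) = g [^] i" for i :: int
    using int_pow_mod g gn by blast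
  have "f \<in> hom (Z n) G"
    using g by (auto simp: f_def hom_def red int_pow_mult)
  moreover have im: "f ` carrier (Z n) = carrier G"
  proof -
    have "g [^] i \<in> f ` carrier (Z n)" for i :: int
      using \<open>n > 0\<close> by (intro image_eqI [of _ _ "i mod int n"]) (auto simp: f_def red carrier_Z)
    then show ?thesis
      using g(2) by (auto simp: f_def)
  qed
  moreover have "inj_on f (carrier (Z n))"
    by (rule eq_card_imp_inj_on) (use \<open>n > 0\<close> im n in \<open>auto simp: finite_Z card_Z\<close>)
  ultimately have "f \<in> iso (Z n) G"
    by (simp add: iso_iff)
  then show ?thesis
    by (meson group.iso_sym group_integer_mod_group is_isoI)
qed

lemma card_isos_cyclic:
  assumes "group G" "cyclic_group G" "finite (carrier G)" "card (carrier G) = n"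
    and "group H" "cyclic_group H" "finite (carrier H)" "card (carrier H) = n"
  shows "card (isos G H) = totient n"
proof -
  have "n > 0"
    using assms group.is_monoid monoid.one_closed card_gt_0_iff by blast
  have "card (isos G H) = card (isos (Z n) (Z n))"
    using assms by (intro card_isos_cong group.cyclic_group_iso_Z) auto
  then show ?thesis
    using card_isos_Z \<open>n > 0\<close> by simp
qed

lemma cyclic_Z: "cyclic_group (Z n)"
proof (cases "n = 1")
  case True
  then show ?thesis
    by (simp add: trivial_imp_cyclic_group trivial_integer_mod_group)
next
  case False
  have "x = 1 [^]\<^bsub>Z n\<^esub> x" if "x \<in> carrier (Z n)" for x :: int
    using that by (auto simp: int_pow_integer_mod_group carrier_integer_mod_group split: if_splits)
  moreover have "1 [^]\<^bsub>Z n\<^esub> x \<in> carrier (Z n)" for x :: int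
    using False by (intro group.int_pow_closed) auto
  ultimately have "carrier (Z n) = range (\<lambda>x::int. 1 [^]\<^bsub>Z n\<^esub> x)"
    by blast
  then show ?thesis
    using False group.cyclic_group [OF group_integer_mod_group] integer_mod_group_1 by blast
qed

subsection \<open>Products of two cyclic groups\<close>

lemma pow_DirProd: "(x, y) [^]\<^bsub>G \<times>\<times> H\<^esub> (n::nat) = (x [^]\<^bsub>G\<^esub> n, y [^]\<^bsub>H\<^esub> n)"
  by (induction n) auto

lemma int_pow_DirProd:
  assumes "group G" "group H" "x \<in> carrier G" "y \<in> carrier H"
  shows "(x, y) [^]\<^bsub>G \<times>\<times> H\<^esub> (i::int) = (x [^]\<^bsub>G\<^esub> i, y [^]\<^bsub>H\<^esub> i)"
proof -
  have "fst \<in> hom (G \<times>\<times> H) G" "snd \<in> hom (G \<times>\<times> H) H"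
    by (auto simp: hom_def)
  then have "fst ((x, y) [^]\<^bsub>G \<times>\<times> H\<^esub> i) = x [^]\<^bsub>G\<^esub> i" "snd ((x, y) [^]\<^bsub>G \<times>\<times> H\<^esub> i) = y [^]\<^bsub>H\<^esub> i"
    using assms by (simp_all add: hom_int_pow DirProd_group)
  then show ?thesis
    by (simp add: prod_eq_iff)
qed

lemma comm_group_DirProd:
  assumes "comm_group G" "comm_group H"
  shows "comm_group (G \<times>\<times> H)"
proof -
  interpret G: comm_group G by fact
  interpret H: comm_group H by fact
  show ?thesis
    by (rule group.group_comm_groupI [OF DirProd_group [OF G.group_axioms H.group_axioms]])
      (auto simp: G.m_comm H.m_comm)
qed

lemma group_ZZ: "group (Z m \<times>\<times> Z n)"
  by (simp add: DirProd_group)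

lemma comm_group_ZZ: "comm_group (Z m \<times>\<times> Z n)"
  by (simp add: comm_group_DirProd)

lemma card_ZZ: "m > 0 \<Longrightarrow> n > 0 \<Longrightarrow> card (carrier (Z m \<times>\<times> Z n)) = m * n"
  by (simp add: card_cartesian_product card_Z)

lemma finite_ZZ: "m > 0 \<Longrightarrow> n > 0 \<Longrightarrow> finite (carrier (Z m \<times>\<times> Z n))"
  by (simp add: finite_Z)

section \<open>Exponents, and the type of an abelian p-group with two generators\<close>

lemma Z_exponent_iff:
  assumes "n > 0"
  shows "(\<forall>x\<in>carrier (Z n). x [^]\<^bsub>Z n\<^esub> k = \<one>\<^bsub>Z n\<^esub>) \<longleftrightarrow> n dvd k"
proof
  assume *: "\<forall>x\<in>carrier (Z n). x [^]\<^bsub>Z n\<^esub> k = \<one>\<^bsub>Z n\<^esub>"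
  show "n dvd k"
  proof (cases "n = 1")
    case False
    then have "1 \<in> carrier (Z n)" by simp
    then have "int k mod int n = 0"
      using * by (metis mult.right_neutral one_integer_mod_group pow_integer_mod_group)
    then show ?thesis
      by (simp add: dvd_eq_mod_eq_0 flip: of_nat_mod)
  qed auto
qed (auto simp: mod_eq_0_iff_dvd)

lemma ZZ_exponent_iff:
  assumes "m dvd n" "n > 0"
  shows "(\<forall>x\<in>carrier (Z m \<times>\<times> Z n). x [^]\<^bsub>Z m \<times>\<times> Z n\<^esub> k = \<one>\<^bsub>Z m \<times>\<times> Z n\<^esub>) \<longleftrightarrow> n dvd k"
proof -
  have "m > 0"
    using assms by (auto intro: Nat.gr0I)
  have "(\<forall>x\<in>carrier (Z m \<times>\<times> Z n). x [^]\<^bsub>Z m \<times>\<times> Z n\<^esub> k = \<one>\<^bsub>Z m \<times>\<times> Z n\<^esub>) \<longleftrightarrow>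
    (\<forall>x\<in>carrier (Z m). x [^]\<^bsub>Z m\<^esub> k = \<one>\<^bsub>Z m\<^esub>) \<and> (\<forall>x\<in>carrier (Z n). x [^]\<^bsub>Z n\<^esub> k = \<one>\<^bsub>Z n\<^esub>)"
    \<comment> \<open>Both carriers contain 0, so the condition on pairs splits into one condition
      for each coordinate.\<close>
    unfolding carrier_DirProd one_DirProd split_paired_Ball_Sigma pow_DirProd prod.inject
    using integer_mod_group_0 [of m] integer_mod_group_0 [of n] by blast
  then show ?thesis
    unfolding Z_exponent_iff [OF \<open>m > 0\<close>] Z_exponent_iff [OF \<open>n > 0\<close>]
    using assms dvd_trans by blast
qed

lemma exponent_cong:
  assumes "group G" "group H" "G \<cong> H"
    and "\<forall>x\<in>carrier G. x [^]\<^bsub>G\<^esub> (k::nat) = \<one>\<^bsub>G\<^esub>"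
  shows "\<forall>x\<in>carrier H. x [^]\<^bsub>H\<^esub> k = \<one>\<^bsub>H\<^esub>"
proof -
  obtain f where f: "f \<in> hom G H" "f ` carrier G = carrier H"
    using assms(3) by (auto simp: is_iso_def iso_iff)
  interpret group_hom G H f
    using assms f by (simp add: group_hom_def group_hom_axioms_def)
  show ?thesis
    using assms(4) by (auto simp: f(2) [symmetric] simp flip: hom_nat_pow)
qed

text \<open>The exponent of the group is \<open>p ^ v\<close> and its order is
  \<open>p ^ (u + v)\<close>, and both are invariant under isomorphism. Sorting the pair rules out
  an exchange of the two factors.\<close>

lemma ZZ_iso_unique:
  assumes p: "prime (p::nat)" and le: "u \<le> v" "u' \<le> v'"
    and iso: "Z (p ^ u) \<times>\<times> Z (p ^ v) \<cong> Z (p ^ u') \<times>\<times> Z (p ^ v')"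
  shows "u = u'" "v = v'"
proof -
  have "p > 1"
    using p by (rule prime_gt_1_nat)
  have iso': "Z (p ^ u') \<times>\<times> Z (p ^ v') \<cong> Z (p ^ u) \<times>\<times> Z (p ^ v)"
    by (rule group.iso_sym [OF group_ZZ iso])
  have d: "p ^ u dvd p ^ v" "p ^ u' dvd p ^ v'"
    using le by (simp_all add: le_imp_power_dvd)
  have "p ^ v' dvd p ^ v"
    using exponent_cong [OF group_ZZ group_ZZ iso, of "p ^ v"] ZZ_exponent_iff [OF d(1)]
      ZZ_exponent_iff [OF d(2)] \<open>p > 1\<close> by auto
  moreover have "p ^ v dvd p ^ v'"
    using exponent_cong [OF group_ZZ group_ZZ iso', of "p ^ v'"] ZZ_exponent_iff [OF d(1)]
      ZZ_exponent_iff [OF d(2)] \<open>p > 1\<close> by auto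
  ultimately show "v = v'"
    using \<open>p > 1\<close> by (metis dvd_antisym power_inject_exp)
  have "p ^ (u + v) = p ^ (u' + v')"
    using iso_same_card [OF iso] \<open>p > 1\<close> by (simp add: card_ZZ power_add del: carrier_DirProd)
  then show "u = u'"
    using \<open>p > 1\<close> \<open>v = v'\<close> by simp
qed

text \<open>The map \<open>(i, j) \<mapsto> g [^] i \<otimes> h [^] j\<close> is a surjective
  homomorphism between finite sets of the same size, hence injective. Independence of
  \<open>g\<close> and \<open>h\<close> thus comes for free from the order.\<close>

lemma (in comm_group) iso_ZZ_of_generators:
  assumes g: "g \<in> carrier G" "g [^] m = \<one>" and h: "h \<in> carrier G" "h [^] n = \<one>"
    and gen: "\<And>x. x \<in> carrier G \<Longrightarrow> \<exists>(i::int) (j::int). x = g [^] i \<otimes> h [^] j"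
    and card: "card (carrier G) = m * n" "m > 0" "n > 0"
  shows "G \<cong> Z m \<times>\<times> Z n"
proof -
  define f where "f = (\<lambda>(i::int, j::int). g [^] i \<otimes> h [^] j)"
  have "f \<in> hom (Z m \<times>\<times> Z n) G"
  proof (rule homI)
    fix x y :: "int \<times> int"
    obtain i j i' j' where xy: "x = (i, j)" "y = (i', j')"
      by (metis surj_pair)
    have "f (x \<otimes>\<^bsub>Z m \<times>\<times> Z n\<^esub> y) = (g [^] i \<otimes> g [^] i') \<otimes> (h [^] j \<otimes> h [^] j')"
      by (simp add: xy f_def int_pow_mod [OF g] int_pow_mod [OF h] int_pow_mult g(1) h(1))
    also have "\<dots> = f x \<otimes> f y"
      using g h by (simp add: xy f_def m_ac)
    finally show "f (x \<otimes>\<^bsub>Z m \<times>\<times> Z n\<^esub> y) = f x \<otimes> f y" .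
  qed (use g h in \<open>auto simp: f_def\<close>)
  moreover have im: "f ` carrier (Z m \<times>\<times> Z n) = carrier G"
  proof
    show "carrier G \<subseteq> f ` carrier (Z m \<times>\<times> Z n)"
    proof
      fix x assume "x \<in> carrier G"
      then obtain i j :: int where "x = g [^] i \<otimes> h [^] j"
        using gen [OF \<open>x \<in> carrier G\<close>] by blast
      then show "x \<in> f ` carrier (Z m \<times>\<times> Z n)"
        using g h card by (intro image_eqI [of _ _ "(i mod int m, j mod int n)"])
          (auto simp: f_def int_pow_mod [OF g] int_pow_mod [OF h] carrier_Z)
    qed
  qed (use g h in \<open>auto simp: f_def\<close>)
  moreover have "inj_on f (carrier (Z m \<times>\<times> Z n))"
    by (rule eq_card_imp_inj_on [OF finite_ZZ])
      (use im card in \<open>simp_all add: card_ZZ del: carrier_DirProd\<close>)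
  ultimately have "f \<in> iso (Z m \<times>\<times> Z n) G"
    by (simp add: iso_iff)
  then show ?thesis
    by (meson group.iso_sym group_ZZ is_isoI)
qed

text \<open>If \<open>h\<close> has maximal order, then \<open>g [^] p ^ u\<close> is a \<open>p ^ u\<close>-th power of some element of the
  subgroup generated by \<open>h\<close>; dividing \<open>g\<close> by that element makes the product of the two cyclic
  subgroups direct.\<close>

lemma (in comm_group) iso_ZZ_of_maximal_generator:
  assumes p: "prime p" and "u \<le> v"
    and g: "g \<in> carrier G" "g [^] (p ^ v) = \<one>" and h: "h \<in> carrier G" "ord h = p ^ v"
    and gen: "\<And>x. x \<in> carrier G \<Longrightarrow> \<exists>(i::int) (j::int). x = g [^] i \<otimes> h [^] j"
    and card: "card (carrier G) = p ^ (u + v)"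
  shows "G \<cong> Z (p ^ u) \<times>\<times> Z (p ^ v)"
proof -
  have "p > 0"
    using p by (simp add: prime_gt_0_nat)
  define C where "C = range (\<lambda>i::int. h [^] i)"
  have C: "subgroup C G"
    unfolding C_def using h(1) by (rule subgroup_of_powers)
  have "card C = p ^ v"
    using cyclic_order_is_ord [OF h(1)] h
    by (simp add: C_def order_def carrier_subgroup_generated_by_singleton)
  then have ord: "order (G Mod C) = p ^ u"
    using lagrange [OF C] card \<open>p > 0\<close> by (simp add: order_def FactGroup_def power_add)
  interpret C: normal C G
    using C by (rule subgroup_imp_normal)
  interpret Q: group "G Mod C"
    by (rule C.factorgroup_is_group)
  \<comment> \<open>The quotient by the cyclic subgroup \<open>C\<close> has order
    \<open>p ^ u\<close>, so it kills the coset of \<open>g\<close> after \<open>p ^ u\<close>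
    steps, which puts \<open>g [^] (p ^ u)\<close> into \<open>C\<close>.\<close>
  have "(C #> g) [^]\<^bsub>G Mod C\<^esub> (p ^ u) = C"
    using Q.pow_order_eq_1 [of "C #> g"] ord g by (simp add: carrier_FactGroup)
  then have "C #> (g [^] (p ^ u)) = C"
    using g by (simp add: C.FactGroup_pow)
  then have "g [^] (p ^ u) \<in> C"
    using coset_join1 [OF _ _ C] g by simp
  then obtain m :: int where m: "g [^] (p ^ u) = h [^] m"
    by (auto simp: C_def)
  \<comment> \<open>Raising \<open>g [^] (p ^ u) = h [^] m\<close> to the power
    \<open>p ^ (v - u)\<close> gives the identity on the left; as \<open>h\<close> has order
    \<open>p ^ v\<close>, this forces \<open>p ^ u\<close> to divide \<open>m\<close>.\<close>
  have "h [^] (m * int (p ^ (v - u))) = (h [^] m) [^] (p ^ (v - u))"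
    using h int_pow_pow [of h m "int (p ^ (v - u))"] by (simp add: int_pow_int flip: of_nat_power)
  also have "\<dots> = g [^] (p ^ u * p ^ (v - u))"
    using g by (simp add: m [symmetric] nat_pow_pow)
  also have "\<dots> = \<one>"
    using g \<open>u \<le> v\<close> by (simp flip: power_add)
  finally have "int (p ^ v) dvd m * int (p ^ (v - u))"
    using h by (simp add: int_pow_eq_id)
  moreover have "int (p ^ v) = int (p ^ u) * int (p ^ (v - u))"
    using \<open>u \<le> v\<close> by (simp flip: power_add)
  ultimately have "int (p ^ u) dvd m"
    using \<open>p > 0\<close> by auto
  then obtain q where q: "m = int (p ^ u) * q" ..
  define g' where "g' = g \<otimes> h [^] (- q)"
  have g': "g' \<in> carrier G"
    using g h by (simp add: g'_def)
  have "g' [^] (p ^ u) = h [^] m \<otimes> (h [^] (- q)) [^] (p ^ u)"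
    using g h by (simp add: g'_def nat_pow_distrib m)
  also have "(h [^] (- q)) [^] (p ^ u) = h [^] (- m)"
    using h int_pow_pow [of h "- q" "int (p ^ u)"]
    by (simp add: q int_pow_int mult.commute flip: of_nat_power)
  also have "h [^] m \<otimes> h [^] (- m) = \<one>"
    using h by (simp flip: int_pow_mult)
  finally have "g' [^] (p ^ u) = \<one>" .
  moreover have "\<exists>(i::int) (j::int). x = g' [^] i \<otimes> h [^] j" if "x \<in> carrier G" for x
  proof -
    obtain i j :: int where x: "x = g [^] i \<otimes> h [^] j"
      using gen [OF \<open>x \<in> carrier G\<close>] by blast
    have "g' [^] i \<otimes> h [^] (q * i + j) = g [^] i \<otimes> (h [^] (- q * i) \<otimes> h [^] (q * i + j))"
      using g h by (simp add: g'_def int_pow_distrib int_pow_pow m_assoc)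
    also have "\<dots> = x"
      using h by (simp add: x flip: int_pow_mult)
    finally show ?thesis by metis
  qed
  moreover have "h [^] (p ^ v) = \<one>"
    using h by (metis pow_ord_eq_1)
  ultimately show ?thesis
    using g' h card \<open>p > 0\<close> by (intro iso_ZZ_of_generators [of g' _ h]) (auto simp: power_add)
qed

text \<open>The orders of the two generators are powers of \<open>p\<close>, and the larger one
  kills the whole group. It therefore equals the exponent \<open>p ^ v\<close>, and the generator
  attaining it serves as the one of maximal order. The exponent enters as a divisibility criterion,
  which can be checked directly in subgroups and quotients.\<close>

lemma (in comm_group) iso_ZZ:
  assumes p: "prime p" and "u \<le> v"
    and gh: "g \<in> carrier G" "h \<in> carrier G"
    and gen: "\<And>x. x \<in> carrier G \<Longrightarrow> \<exists>(i::int) (j::int). x = g [^] i \<otimes> h [^] j"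
    and card: "card (carrier G) = p ^ (u + v)"
    and exp: "\<And>n. (\<forall>x\<in>carrier G. x [^] n = \<one>) \<longleftrightarrow> p ^ v dvd n"
  shows "G \<cong> Z (p ^ u) \<times>\<times> Z (p ^ v)"
proof -
  have one: "g [^] (p ^ v) = \<one>" "h [^] (p ^ v) = \<one>"
    using gh exp [of "p ^ v"] by auto
  then have "ord g dvd p ^ v" "ord h dvd p ^ v"
    using gh by (simp_all flip: pow_eq_id)
  then obtain i j where ij: "ord g = p ^ i" "ord h = p ^ j" "i \<le> v" "j \<le> v"
    using divides_primepow_nat [OF p] by metis
  have "x [^] (p ^ max i j) = \<one>" if "x \<in> carrier G" for x
  proof -
    obtain k l :: int where x: "x = g [^] k \<otimes> h [^] l"
      using gen [OF \<open>x \<in> carrier G\<close>] by blast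
    have "(g [^] k) [^] (p ^ max i j) = \<one>"
    proof -
      have "(g [^] k) [^] (p ^ max i j) = g [^] (k * int (p ^ max i j))"
        using gh int_pow_pow [of g k "int (p ^ max i j)"] by (simp add: int_pow_int del: of_nat_power)
      then show ?thesis
        using gh ij(1) by (simp add: int_pow_eq_id le_imp_power_dvd)
    qed
    moreover have "(h [^] l) [^] (p ^ max i j) = \<one>"
    proof -
      have "(h [^] l) [^] (p ^ max i j) = h [^] (l * int (p ^ max i j))"
        using gh int_pow_pow [of h l "int (p ^ max i j)"] by (simp add: int_pow_int del: of_nat_power)
      then show ?thesis
        using gh ij(2) by (simp add: int_pow_eq_id le_imp_power_dvd)
    qed
    ultimately show ?thesis
      using gh by (simp add: x nat_pow_distrib)
  qed
  then have "p ^ v dvd p ^ max i j"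
    using exp by blast
  then have "v \<le> max i j"
    using prime_gt_1_nat [OF p] by (rule power_dvd_imp_le)
  then consider "i = v" | "j = v"
    using ij by linarith
  then show ?thesis
  proof cases
    case 1
    have "\<exists>(i::int) (j::int). x = h [^] i \<otimes> g [^] j" if "x \<in> carrier G" for x
      using gen [OF that] gh by (metis m_comm int_pow_closed)
    then show ?thesis
      using gh one ij 1 card by (intro iso_ZZ_of_maximal_generator [OF p \<open>u \<le> v\<close>, of h g]) auto
  next
    case 2
    then show ?thesis
      using gh one ij card gen by (intro iso_ZZ_of_maximal_generator [OF p \<open>u \<le> v\<close>, of g h]) auto
  qed
qed

subsection \<open>Goursat's lemma\<close>

definition subgroup_chains :: "('a, 'c) monoid_scheme \<Rightarrow> ('a set \<times> 'a set) set" where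
  "subgroup_chains G = {(A, B). subgroup A G \<and> subgroup B G \<and> B \<subseteq> A}"

definition chain_quot :: "('a, 'c) monoid_scheme \<Rightarrow> 'a set \<times> 'a set \<Rightarrow> 'a set monoid" where
  "chain_quot G = (\<lambda>(A, B). G\<lparr>carrier := A\<rparr> Mod B)"

text \<open>On each side this is the projection of \<open>K\<close>, followed by the intersection of
  \<open>K\<close> with that factor.\<close>

definition goursat ::
    "('a, 'c) monoid_scheme \<Rightarrow> ('b, 'd) monoid_scheme \<Rightarrow> ('a \<times> 'b) set \<Rightarrow>
      ('a set \<times> 'a set) \<times> ('b set \<times> 'b set)" where
  "goursat G H K = ((fst ` K, {g. (g, \<one>\<^bsub>H\<^esub>) \<in> K}), (snd ` K, {h. (\<one>\<^bsub>G\<^esub>, h) \<in> K}))"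

text \<open>This is the fibre product of \<open>A\<close> and \<open>C\<close> over their quotients,
  which are identified by \<open>\<theta>\<close>.\<close>

definition goursat_graph ::
    "('a, 'c) monoid_scheme \<Rightarrow> ('b, 'd) monoid_scheme \<Rightarrow> 'a set \<times> 'a set \<Rightarrow> 'b set \<times> 'b set \<Rightarrow>
      ('a set \<Rightarrow> 'b set) \<Rightarrow> ('a \<times> 'b) set" where
  "goursat_graph G H = (\<lambda>(A, B) (C, D) \<theta>. {(g, h) \<in> A \<times> C. \<theta> (B #>\<^bsub>G\<^esub> g) = D #>\<^bsub>H\<^esub> h})"

lemma (in comm_group) chain_quot_facts:
  assumes "(A, B) \<in> subgroup_chains G"
  shows "comm_group (chain_quot G (A, B))" "normal B (G\<lparr>carrier := A\<rparr>)"
    "group (G\<lparr>carrier := A\<rparr>)" "group_hom (G\<lparr>carrier := A\<rparr>) (chain_quot G (A, B)) (\<lambda>x. B #> x)"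
    "carrier (chain_quot G (A, B)) = (\<lambda>x. B #> x) ` A" "\<one>\<^bsub>chain_quot G (A, B)\<^esub> = B"
proof -
  have A: "subgroup A G" and B: "subgroup B G" "B \<subseteq> A"
    using assms by (auto simp: subgroup_chains_def)
  interpret A: comm_group "G\<lparr>carrier := A\<rparr>"
    by (rule group.group_comm_groupI [OF subgroup.subgroup_is_group [OF A group_axioms]])
      (use subgroup.subset [OF A] m_comm in auto)
  have BA: "subgroup B (G\<lparr>carrier := A\<rparr>)"
    using subgroup_incl [OF B(1) A B(2)] .
  show "normal B (G\<lparr>carrier := A\<rparr>)"
    using BA by (rule A.subgroup_imp_normal)
  then interpret N: normal B "G\<lparr>carrier := A\<rparr>" .
  show "comm_group (chain_quot G (A, B))"
    unfolding chain_quot_def by (simp add: A.abelian_FactGroup [OF BA])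
  then show "group_hom (G\<lparr>carrier := A\<rparr>) (chain_quot G (A, B)) (\<lambda>x. B #> x)"
    using N.r_coset_hom_Mod A.group_axioms
    by (simp add: group_hom_def group_hom_axioms_def chain_quot_def comm_group_def)
  show "carrier (chain_quot G (A, B)) = (\<lambda>x. B #> x) ` A" "\<one>\<^bsub>chain_quot G (A, B)\<^esub> = B"
    by (auto simp: chain_quot_def carrier_FactGroup)
  show "group (G\<lparr>carrier := A\<rparr>)"
    by (rule A.group_axioms)
qed

locale two_comm_groups = G: comm_group G + H: comm_group H
  for G :: "('a, 'c) monoid_scheme" (structure) and H :: "('b, 'd) monoid_scheme" (structure)
begin

lemma comm_group_prod: "comm_group (G \<times>\<times> H)"
  by (rule comm_group_DirProd) unfold_locales

lemma group_prod: "group (G \<times>\<times> H)"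
  using comm_group_prod by (rule comm_group.axioms)

lemma subgroup_prodD:
  assumes "subgroup K (G \<times>\<times> H)"
  shows "(g, h) \<in> K \<Longrightarrow> g \<in> carrier G" "(g, h) \<in> K \<Longrightarrow> h \<in> carrier H"
    "(\<one>\<^bsub>G\<^esub>, \<one>\<^bsub>H\<^esub>) \<in> K"
    "(g, h) \<in> K \<Longrightarrow> (g', h') \<in> K \<Longrightarrow> (g \<otimes>\<^bsub>G\<^esub> g', h \<otimes>\<^bsub>H\<^esub> h') \<in> K"
    "(g, h) \<in> K \<Longrightarrow> (inv\<^bsub>G\<^esub> g, inv\<^bsub>H\<^esub> h) \<in> K"
proof -
  interpret K: subgroup K "G \<times>\<times> H" by fact
  show c: "(g, h) \<in> K \<Longrightarrow> g \<in> carrier G" "(g, h) \<in> K \<Longrightarrow> h \<in> carrier H"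
    using K.subset by auto
  show "(\<one>\<^bsub>G\<^esub>, \<one>\<^bsub>H\<^esub>) \<in> K"
    using K.one_closed by simp
  show "(g, h) \<in> K \<Longrightarrow> (g', h') \<in> K \<Longrightarrow> (g \<otimes>\<^bsub>G\<^esub> g', h \<otimes>\<^bsub>H\<^esub> h') \<in> K"
    using K.m_closed [of "(g, h)" "(g', h')"] by simp
  show "(g, h) \<in> K \<Longrightarrow> (inv\<^bsub>G\<^esub> g, inv\<^bsub>H\<^esub> h) \<in> K"
    using K.m_inv_closed [of "(g, h)"] c by simp
qed

lemma goursat_chains:
  assumes K: "subgroup K (G \<times>\<times> H)"
  shows "goursat G H K \<in> subgroup_chains G \<times> subgroup_chains H"
proof -
  note D = subgroup_prodD [OF K]
  have "fst \<in> hom (G \<times>\<times> H) G" "snd \<in> hom (G \<times>\<times> H) H"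
    by (auto simp: hom_def)
  then have "subgroup (fst ` K) G" "subgroup (snd ` K) H"
    using K group_prod by (auto intro!: group_hom.subgroup_img_is_subgroup
        simp: group_hom_def group_hom_axioms_def)
  moreover have "subgroup {g. (g, \<one>\<^bsub>H\<^esub>) \<in> K} G"
    by (rule G.subgroupI) (use D(1,3) D(4) [of _ "\<one>\<^bsub>H\<^esub>" _ "\<one>\<^bsub>H\<^esub>"] D(5) [of _ "\<one>\<^bsub>H\<^esub>"] in auto)
  moreover have "subgroup {h. (\<one>\<^bsub>G\<^esub>, h) \<in> K} H"
    by (rule H.subgroupI) (use D(2,3) D(4) [of "\<one>\<^bsub>G\<^esub>" _ "\<one>\<^bsub>G\<^esub>"] D(5) [of "\<one>\<^bsub>G\<^esub>"] in auto)
  ultimately show ?thesis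
    by (force simp: goursat_def subgroup_chains_def)
qed

text \<open>Two elements of \<open>K\<close> with the same first component differ by an element of
  the form \<open>(\<one>, k)\<close>. The slices give both the order of \<open>K\<close> and the
  homomorphism from which \<open>\<theta>\<close> is recovered.\<close>

lemma slice_eq_coset:
  assumes K: "subgroup K (G \<times>\<times> H)" and gh: "(g, h) \<in> K"
  shows "{h'. (g, h') \<in> K} = {h. (\<one>\<^bsub>G\<^esub>, h) \<in> K} #>\<^bsub>H\<^esub> h"
proof -
  note D = subgroup_prodD [OF K]
  have [simp]: "g \<in> carrier G" "h \<in> carrier H"
    using D gh by auto
  have "\<exists>k. (\<one>\<^bsub>G\<^esub>, k) \<in> K \<and> h' = k \<otimes>\<^bsub>H\<^esub> h" if "(g, h') \<in> K" for h'
  proof -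
    have "(g \<otimes>\<^bsub>G\<^esub> inv\<^bsub>G\<^esub> g, h' \<otimes>\<^bsub>H\<^esub> inv\<^bsub>H\<^esub> h) \<in> K"
      using D(4) [OF that D(5) [OF gh]] .
    moreover have "h' \<otimes>\<^bsub>H\<^esub> inv\<^bsub>H\<^esub> h \<otimes>\<^bsub>H\<^esub> h = h'"
      using D(2) [OF that] by (simp add: H.m_assoc)
    ultimately show ?thesis
      by (intro exI [of _ "h' \<otimes>\<^bsub>H\<^esub> inv\<^bsub>H\<^esub> h"]) simp
  qed
  moreover have "(g, k \<otimes>\<^bsub>H\<^esub> h) \<in> K" if "(\<one>\<^bsub>G\<^esub>, k) \<in> K" for k
    using D(4) [OF that gh] by simp
  ultimately show ?thesis
    by (auto simp: r_coset_def)
qed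

text \<open>\<open>K\<close> fibres over its first projection, and every fibre is a coset of the
  same subgroup of \<open>H\<close>.\<close>

lemma card_subgroup_prod:
  assumes K: "subgroup K (G \<times>\<times> H)" and fin: "finite (carrier G)" "finite (carrier H)"
  shows "card K = card (fst ` K) * card {h. (\<one>\<^bsub>G\<^esub>, h) \<in> K}"
proof -
  let ?D = "{h. (\<one>\<^bsub>G\<^esub>, h) \<in> K}"
  have D: "subgroup ?D H" and "subgroup (fst ` K) G"
    using goursat_chains [OF K] by (auto simp: goursat_def subgroup_chains_def)
  then have "finite (fst ` K)"
    using fin subgroup.subset finite_subset by metis
  have K_eq: "K = (SIGMA g:fst ` K. {h. (g, h) \<in> K})"
    by force
  have "card {h. (g, h) \<in> K} = card ?D" if "g \<in> fst ` K" for g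
  proof -
    obtain h where gh: "(g, h) \<in> K" using \<open>g \<in> fst ` K\<close> by auto
    then have "?D #>\<^bsub>H\<^esub> h \<in> rcosets\<^bsub>H\<^esub> ?D"
      using subgroup_prodD [OF K] subgroup.subset [OF D] by (intro H.rcosetsI) auto
    then show ?thesis
      using slice_eq_coset [OF K gh] H.card_rcosets_equal subgroup.subset [OF D] by metis
  qed
  moreover have "finite {h. (g, h) \<in> K}" for g
    using subgroup_prodD(2) [OF K] by (auto intro: finite_subset [OF _ fin(2)])
  ultimately show ?thesis
    using \<open>finite (fst ` K)\<close> by (subst K_eq) (subst card_SigmaI, auto)
qed

context
  fixes A B C D
  assumes AB: "(A, B) \<in> subgroup_chains G" and CD: "(C, D) \<in> subgroup_chains H"
begin

interpretation X: comm_group "chain_quot G (A, B)"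
  using G.chain_quot_facts(1) [OF AB] .

interpretation Y: comm_group "chain_quot H (C, D)"
  using H.chain_quot_facts(1) [OF CD] .

interpretation qA: group_hom "G\<lparr>carrier := A\<rparr>" "chain_quot G (A, B)" "\<lambda>x. B #>\<^bsub>G\<^esub> x"
  using G.chain_quot_facts(4) [OF AB] .

interpretation qC: group_hom "H\<lparr>carrier := C\<rparr>" "chain_quot H (C, D)" "\<lambda>x. D #>\<^bsub>H\<^esub> x"
  using H.chain_quot_facts(4) [OF CD] .

private lemma subgroups: "subgroup A G" "subgroup B G" "B \<subseteq> A" "subgroup C H" "subgroup D H" "D \<subseteq> C"
  using AB CD by (auto simp: subgroup_chains_def)

private lemma carriers: "x \<in> A \<Longrightarrow> x \<in> carrier G" "x \<in> B \<Longrightarrow> x \<in> carrier G"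
    "y \<in> C \<Longrightarrow> y \<in> carrier H" "y \<in> D \<Longrightarrow> y \<in> carrier H"
  using subgroups by (auto dest: subgroup.subset)

private lemma coset_B: "x \<in> A \<Longrightarrow> B #>\<^bsub>G\<^esub> x = B \<longleftrightarrow> x \<in> B"
  using G.coset_join1 G.coset_join2 subgroups carriers by metis

private lemma coset_D: "y \<in> C \<Longrightarrow> D #>\<^bsub>H\<^esub> y = D \<longleftrightarrow> y \<in> D"
  using H.coset_join1 H.coset_join2 subgroups carriers by metis

text \<open>Surjectivity of \<open>\<theta>\<close> makes the second projection all of
  \<open>C\<close>, and injectivity makes the intersection with the first factor no larger than
  \<open>B\<close>. The other two components need only that \<open>\<theta>\<close> is a
  homomorphism into the quotient.\<close>

lemma goursat_graph_subgroup:
  assumes \<theta>: "\<theta> \<in> isos (chain_quot G (A, B)) (chain_quot H (C, D))"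
  shows "subgroup (goursat_graph G H (A, B) (C, D) \<theta>) (G \<times>\<times> H)"
    and "goursat G H (goursat_graph G H (A, B) (C, D) \<theta>) = ((A, B), (C, D))"
proof -
  have hom: "\<theta> \<in> hom (chain_quot G (A, B)) (chain_quot H (C, D))"
    and bij: "bij_betw \<theta> (carrier (chain_quot G (A, B))) (carrier (chain_quot H (C, D)))"
    using \<theta> by (auto simp: isos_def iso_def)
  interpret \<theta>: group_hom "chain_quot G (A, B)" "chain_quot H (C, D)" \<theta>
    using hom by unfold_locales
  let ?K = "goursat_graph G H (A, B) (C, D) \<theta>"
  have K: "(g, h) \<in> ?K \<longleftrightarrow> g \<in> A \<and> h \<in> C \<and> \<theta> (B #>\<^bsub>G\<^esub> g) = D #>\<^bsub>H\<^esub> h" for g h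
    by (auto simp: goursat_graph_def)
  have X: "carrier (chain_quot G (A, B)) = (\<lambda>x. B #>\<^bsub>G\<^esub> x) ` A" "\<one>\<^bsub>chain_quot G (A, B)\<^esub> = B"
    using G.chain_quot_facts [OF AB] by auto
  have Y: "carrier (chain_quot H (C, D)) = (\<lambda>x. D #>\<^bsub>H\<^esub> x) ` C" "\<one>\<^bsub>chain_quot H (C, D)\<^esub> = D"
    using H.chain_quot_facts [OF CD] by auto
  have \<theta>B: "\<theta> B = D"
    using \<theta>.hom_one X Y by simp
  have mem [simp]: "\<one>\<^bsub>G\<^esub> \<in> A" "\<one>\<^bsub>H\<^esub> \<in> C" "B #>\<^bsub>G\<^esub> \<one>\<^bsub>G\<^esub> = B" "D #>\<^bsub>H\<^esub> \<one>\<^bsub>H\<^esub> = D"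
    using subgroups by (simp_all add: subgroup.one_closed subgroup.subset)
  have memX: "x \<in> A \<Longrightarrow> B #>\<^bsub>G\<^esub> x \<in> carrier (chain_quot G (A, B))" for x
    using X by auto
  show "subgroup ?K (G \<times>\<times> H)"
  proof (rule group.subgroupI [OF group_prod])
    show "?K \<subseteq> carrier (G \<times>\<times> H)"
      using carriers by (auto simp: K)
    have "(\<one>\<^bsub>G\<^esub>, \<one>\<^bsub>H\<^esub>) \<in> ?K"
      by (simp add: K \<theta>B)
    then show "?K \<noteq> {}" by blast
  next
    fix a assume "a \<in> ?K"
    then obtain g h where a: "a = (g, h)" and gh: "g \<in> A" "h \<in> C" "\<theta> (B #>\<^bsub>G\<^esub> g) = D #>\<^bsub>H\<^esub> h"
      by (auto simp: goursat_graph_def)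
    have "\<theta> (B #>\<^bsub>G\<^esub> inv\<^bsub>G\<^esub> g) = D #>\<^bsub>H\<^esub> inv\<^bsub>H\<^esub> h"
      using qA.hom_inv [of g] qC.hom_inv [of h] \<theta>.hom_inv [OF memX, of g] gh subgroups by simp
    then show "inv\<^bsub>G \<times>\<times> H\<^esub> a \<in> ?K"
      using gh carriers subgroups by (auto simp: a K subgroup.m_inv_closed)
  next
    fix a b assume "a \<in> ?K" "b \<in> ?K"
    then obtain g h g' h' where ab: "a = (g, h)" "b = (g', h')"
      and gh: "g \<in> A" "h \<in> C" "\<theta> (B #>\<^bsub>G\<^esub> g) = D #>\<^bsub>H\<^esub> h"
        "g' \<in> A" "h' \<in> C" "\<theta> (B #>\<^bsub>G\<^esub> g') = D #>\<^bsub>H\<^esub> h'"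
      by (auto simp: goursat_graph_def)
    have "\<theta> (B #>\<^bsub>G\<^esub> (g \<otimes>\<^bsub>G\<^esub> g')) = D #>\<^bsub>H\<^esub> (h \<otimes>\<^bsub>H\<^esub> h')"
      using qA.hom_mult [of g g'] qC.hom_mult [of h h'] \<theta>.hom_mult [OF memX memX, of g g'] gh
      by simp
    then show "a \<otimes>\<^bsub>G \<times>\<times> H\<^esub> b \<in> ?K"
      using gh subgroups by (auto simp: ab K subgroup.m_closed)
  qed
  have "\<exists>h. (g, h) \<in> ?K" if "g \<in> A" for g
  proof -
    have "\<theta> (B #>\<^bsub>G\<^esub> g) \<in> carrier (chain_quot H (C, D))"
      using memX [OF that] by simp
    then show ?thesis
      using that by (auto simp: K Y)
  qed
  then have 1: "fst ` ?K = A"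
    by (force simp: goursat_graph_def)
  have "\<exists>g. (g, h) \<in> ?K" if "h \<in> C" for h
  proof -
    have "D #>\<^bsub>H\<^esub> h \<in> \<theta> ` carrier (chain_quot G (A, B))"
      using bij that Y by (auto simp: bij_betw_def)
    then show ?thesis
      using that by (auto simp: K X)
  qed
  then have 2: "snd ` ?K = C"
    by (force simp: goursat_graph_def)
  have "g \<in> A \<Longrightarrow> \<theta> (B #>\<^bsub>G\<^esub> g) = D \<longleftrightarrow> g \<in> B" for g
  proof -
    assume "g \<in> A"
    have "\<theta> (B #>\<^bsub>G\<^esub> g) = \<theta> B \<longleftrightarrow> B #>\<^bsub>G\<^esub> g = B"
      using bij memX [OF \<open>g \<in> A\<close>] memX [OF mem(1)] by (auto simp: bij_betw_def inj_on_def)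
    then show ?thesis
      using \<theta>B coset_B [OF \<open>g \<in> A\<close>] by simp
  qed
  then have 3: "{g. (g, \<one>\<^bsub>H\<^esub>) \<in> ?K} = B"
    using subgroups by (auto simp: K)
  have 4: "{h. (\<one>\<^bsub>G\<^esub>, h) \<in> ?K} = D"
    using subgroups coset_D by (auto simp: K \<theta>B)
  show "goursat G H ?K = ((A, B), (C, D))"
    by (simp add: goursat_def 1 2 3 4)
qed

lemma goursat_graph_inj: "inj_on (goursat_graph G H (A, B) (C, D)) (isos (chain_quot G (A, B)) (chain_quot H (C, D)))"
proof (rule inj_onI)
  fix \<theta> \<theta>' assume \<theta>: "\<theta> \<in> isos (chain_quot G (A, B)) (chain_quot H (C, D))"
      "\<theta>' \<in> isos (chain_quot G (A, B)) (chain_quot H (C, D))"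
    and eq: "goursat_graph G H (A, B) (C, D) \<theta> = goursat_graph G H (A, B) (C, D) \<theta>'"
  show "\<theta> = \<theta>'"
  proof (rule extensionalityI [of _ "carrier (chain_quot G (A, B))"])
    fix x assume x: "x \<in> carrier (chain_quot G (A, B))"
    then obtain g where g: "g \<in> A" "x = B #>\<^bsub>G\<^esub> g"
      using G.chain_quot_facts(5) [OF AB] by auto
    have "\<theta> x \<in> carrier (chain_quot H (C, D))"
      using \<theta> x by (auto simp: isos_def iso_def hom_def)
    then obtain h where h: "h \<in> C" "\<theta> x = D #>\<^bsub>H\<^esub> h"
      using H.chain_quot_facts(5) [OF CD] by auto
    then have "(g, h) \<in> goursat_graph G H (A, B) (C, D) \<theta>'"
      using g by (simp add: eq [symmetric]) (simp add: goursat_graph_def)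
    then show "\<theta> x = \<theta>' x"
      using g h by (simp add: goursat_graph_def)
  qed (use \<theta> in \<open>auto simp: isos_def\<close>)
qed

text \<open>A subdirect subgroup \<open>K\<close> yields the homomorphism sending \<open>g\<close> to its slice, which is a coset
  of \<open>D\<close>; its kernel is \<open>B\<close>.\<close>

lemma goursat_graph_surj:
  assumes K: "subgroup K (G \<times>\<times> H)" and data: "goursat G H K = ((A, B), (C, D))"
  shows "K \<in> goursat_graph G H (A, B) (C, D) ` isos (chain_quot G (A, B)) (chain_quot H (C, D))"
proof -
  note E = subgroup_prodD [OF K]
  have A: "A = fst ` K" and B: "B = {g. (g, \<one>\<^bsub>H\<^esub>) \<in> K}"
    and C: "C = snd ` K" and D: "D = {h. (\<one>\<^bsub>G\<^esub>, h) \<in> K}"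
    using data by (auto simp: goursat_def)
  define f where "f g = {h. (g, h) \<in> K}" for g
  have f: "f g = D #>\<^bsub>H\<^esub> h" if "(g, h) \<in> K" for g h
    using slice_eq_coset [OF K that] by (simp add: f_def D)
  have fD: "f g = D \<longleftrightarrow> (g, \<one>\<^bsub>H\<^esub>) \<in> K" if "g \<in> A" for g
  proof
    assume "f g = D"
    moreover have "\<one>\<^bsub>H\<^esub> \<in> D" using E D by simp
    ultimately show "(g, \<one>\<^bsub>H\<^esub>) \<in> K" by (auto simp: f_def)
  next
    assume "(g, \<one>\<^bsub>H\<^esub>) \<in> K"
    then show "f g = D"
      using f subgroups(5) by (simp add: subgroup.subset)
  qed
  have "f \<in> hom (G\<lparr>carrier := A\<rparr>) (chain_quot H (C, D))"
  proof (rule homI)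
    fix x assume "x \<in> carrier (G\<lparr>carrier := A\<rparr>)"
    then obtain h where h: "(x, h) \<in> K"
      by (auto simp: A)
    then have "h \<in> C" by (force simp: C)
    then show "f x \<in> carrier (chain_quot H (C, D))"
      using f [OF h] by (simp add: H.chain_quot_facts(5) [OF CD])
  next
    fix x y assume "x \<in> carrier (G\<lparr>carrier := A\<rparr>)" "y \<in> carrier (G\<lparr>carrier := A\<rparr>)"
    then obtain h k where hk: "(x, h) \<in> K" "(y, k) \<in> K"
      by (auto simp: A)
    then have "h \<in> C" "k \<in> C" by (force simp: C)+
    then show "f (x \<otimes>\<^bsub>G\<lparr>carrier := A\<rparr>\<^esub> y) = f x \<otimes>\<^bsub>chain_quot H (C, D)\<^esub> f y"
      using f [OF hk(1)] f [OF hk(2)] f [OF E(4) [OF hk]] qC.hom_mult [of h k] by simp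
  qed
  then interpret f: group_hom "G\<lparr>carrier := A\<rparr>" "chain_quot H (C, D)" f
    by (simp add: group_hom_def group_hom_axioms_def qA.G.group_axioms Y.group_axioms)
  have ker: "kernel (G\<lparr>carrier := A\<rparr>) (chain_quot H (C, D)) f = B"
    using fD subgroups by (auto simp: kernel_def H.chain_quot_facts(6) [OF CD] B)
  have "f ` A = carrier (chain_quot H (C, D))"
  proof
    show "f ` A \<subseteq> carrier (chain_quot H (C, D))"
      using f.homh by (auto simp: hom_def)
    have "D #>\<^bsub>H\<^esub> h \<in> f ` A" if "(g, h) \<in> K" for g h
      using f [OF that] that by (force simp: A)
    then show "carrier (chain_quot H (C, D)) \<subseteq> f ` A"
      unfolding H.chain_quot_facts(5) [OF CD] by (auto simp: C)
  qed
  \<comment> \<open>First isomorphism theorem: \<open>f\<close> is constant on each coset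
    \<open>X\<close> of its kernel \<open>B\<close>, and \<open>the_elem\<close> extracts that
    constant value.\<close>
  then have iso: "(\<lambda>X. the_elem (f ` X)) \<in> iso (chain_quot G (A, B)) (chain_quot H (C, D))"
    using f.FactGroup_iso_set unfolding ker by (simp add: chain_quot_def)
  define \<theta> where "\<theta> = restrict (\<lambda>X. the_elem (f ` X)) (carrier (chain_quot G (A, B)))"
  have "\<theta> \<in> isos (chain_quot G (A, B)) (chain_quot H (C, D))"
    using X.iso_eq [OF iso, of \<theta>] by (simp add: \<theta>_def isos_def)
  moreover have \<theta>: "\<theta> (B #>\<^bsub>G\<^esub> g) = f g" if "g \<in> A" for g
  proof -
    have "f x = f g" if x: "x \<in> B #>\<^bsub>G\<^esub> g" for x
    proof -
      obtain b where b: "b \<in> B" "x = b \<otimes>\<^bsub>G\<^esub> g"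
        using x by (auto simp: r_coset_def)
      obtain h where h: "(g, h) \<in> K"
        using \<open>g \<in> A\<close> by (auto simp: A)
      have "(x, h) \<in> K"
        using E(4) [of b "\<one>\<^bsub>H\<^esub>" g h] b h E(2) [OF h] by (simp add: B)
      then show ?thesis
        using f h by simp
    qed
    moreover have "g \<in> B #>\<^bsub>G\<^esub> g"
      using that carriers subgroups by (intro G.rcos_self)
    ultimately have "f ` (B #>\<^bsub>G\<^esub> g) = {f g}"
      by blast
    then show ?thesis
      using that by (simp add: \<theta>_def G.chain_quot_facts(5) [OF AB])
  qed
  have "(g, h) \<in> K \<longleftrightarrow> g \<in> A \<and> h \<in> C \<and> \<theta> (B #>\<^bsub>G\<^esub> g) = D #>\<^bsub>H\<^esub> h" for g h
  proof
    assume gh: "(g, h) \<in> K"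
    then have "g \<in> A" "h \<in> C" by (force simp: A C)+
    then show "g \<in> A \<and> h \<in> C \<and> \<theta> (B #>\<^bsub>G\<^esub> g) = D #>\<^bsub>H\<^esub> h"
      using \<theta> f [OF gh] by simp
  next
    assume *: "g \<in> A \<and> h \<in> C \<and> \<theta> (B #>\<^bsub>G\<^esub> g) = D #>\<^bsub>H\<^esub> h"
    then have "h \<in> f g"
      using \<theta> [of g] H.rcos_self [OF carriers(3) subgroups(5), of h] by auto
    then show "(g, h) \<in> K" by (simp add: f_def)
  qed
  then have "K = goursat_graph G H (A, B) (C, D) \<theta>"
    by (auto simp: goursat_graph_def)
  ultimately show ?thesis
    by blast
qed

text \<open>For fixed data, subgroups correspond to isomorphisms of the quotients. If the quotients
  are not isomorphic, both sides are 0.\<close>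

lemma card_goursat_fiber:
  "card {K. subgroup K (G \<times>\<times> H) \<and> goursat G H K = ((A, B), (C, D))} =
    card (isos (chain_quot G (A, B)) (chain_quot H (C, D)))"
proof -
  have "{K. subgroup K (G \<times>\<times> H) \<and> goursat G H K = ((A, B), (C, D))} =
      goursat_graph G H (A, B) (C, D) ` isos (chain_quot G (A, B)) (chain_quot H (C, D))"
    using goursat_graph_subgroup goursat_graph_surj by blast
  then show ?thesis
    by (simp add: card_image goursat_graph_inj)
qed

end

end

section \<open>Generators of a subgroup of a product with cyclic Goursat components\<close>

lemma (in group) cyclic_subgroup:
  assumes A: "subgroup A G" and "cyclic_group (G\<lparr>carrier := A\<rparr>)"
  shows "\<exists>x\<in>A. A = range (\<lambda>i::int. x [^] i)"
proof -
  interpret A: group "G\<lparr>carrier := A\<rparr>"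
    by (rule subgroup.subgroup_is_group [OF A group_axioms])
  obtain x where "x \<in> carrier (G\<lparr>carrier := A\<rparr>)"
      "carrier (G\<lparr>carrier := A\<rparr>) = range (\<lambda>i::int. x [^]\<^bsub>G\<lparr>carrier := A\<rparr>\<^esub> i)"
    using iffD1 [OF A.cyclic_group assms(2)] by (rule bexE)
  then have x: "x \<in> A" and A_eq: "A = range (\<lambda>i::int. x [^]\<^bsub>G\<lparr>carrier := A\<rparr>\<^esub> i)"
    by simp_all
  have "A = range (\<lambda>i::int. x [^] i)"
    unfolding int_pow_consistent [OF A x] by (rule A_eq)
  then show ?thesis
    using x by (rule bexI)
qed

text \<open>\<open>K\<close> is an extension of its first projection by its intersection with
  \<open>H\<close>. A lift of a generator of the former and a generator of the latter together
  generate \<open>K\<close>.\<close>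

lemma (in two_comm_groups) subgroup_prod_generators:
  assumes K: "subgroup K (G \<times>\<times> H)"
    and gen: "cyclic_group (G\<lparr>carrier := fst ` K\<rparr>)"
      "cyclic_group (H\<lparr>carrier := {h. (\<one>\<^bsub>G\<^esub>, h) \<in> K}\<rparr>)"
  obtains g h where "g \<in> K" "h \<in> K"
    "\<And>x. x \<in> K \<Longrightarrow> \<exists>(i::int) (j::int). x = g [^]\<^bsub>G \<times>\<times> H\<^esub> i \<otimes>\<^bsub>G \<times>\<times> H\<^esub> h [^]\<^bsub>G \<times>\<times> H\<^esub> j"
proof -
  interpret P: group "G \<times>\<times> H" by (rule group_prod)
  let ?A = "fst ` K" and ?D = "{h. (\<one>\<^bsub>G\<^esub>, h) \<in> K}"
  note E = subgroup_prodD [OF K]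
  have A: "subgroup ?A G" and D: "subgroup ?D H"
    using goursat_chains [OF K] by (auto simp: goursat_def subgroup_chains_def)
  obtain e where e: "e \<in> ?A" "?A = range (\<lambda>i::int. e [^]\<^bsub>G\<^esub> i)"
    using G.cyclic_subgroup [OF A gen(1)] by (rule bexE)
  obtain d where d: "d \<in> ?D" "?D = range (\<lambda>i::int. d [^]\<^bsub>H\<^esub> i)"
    using H.cyclic_subgroup [OF D gen(2)] by (rule bexE)
  obtain y where y: "(e, y) \<in> K" using e(1) by auto
  note pow = int_pow_DirProd [OF G.group_axioms H.group_axioms]
  show thesis
  proof
    show "(e, y) \<in> K" "(\<one>\<^bsub>G\<^esub>, d) \<in> K" using y d by auto
    fix x assume "x \<in> K"
    then obtain g h where x: "x = (g, h)" and gh: "(g, h) \<in> K"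
      by (cases x) auto
    then have "g \<in> ?A" by force
    then obtain i :: int where i: "g = e [^]\<^bsub>G\<^esub> i"
      using e by auto
    have c: "e \<in> carrier G" "y \<in> carrier H" "d \<in> carrier H" "h \<in> carrier H"
      using E(1,2) y d(1) gh by blast+
    have "(e, y) [^]\<^bsub>G \<times>\<times> H\<^esub> i \<in> K"
      using P.subgroup_int_pow_closed [OF K y] .
    then have "(g, y [^]\<^bsub>H\<^esub> i) \<in> K"
      using c by (simp add: pow i)
    \<comment> \<open>Dividing by the power of the lift \<open>(e, y)\<close> that has the same
      first component leaves an element of the intersection with \<open>H\<close>.\<close>
    then have "(g \<otimes>\<^bsub>G\<^esub> inv\<^bsub>G\<^esub> g, h \<otimes>\<^bsub>H\<^esub> inv\<^bsub>H\<^esub> (y [^]\<^bsub>H\<^esub> i)) \<in> K"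
      using E(4) [OF gh E(5)] by blast
    then have "h \<otimes>\<^bsub>H\<^esub> inv\<^bsub>H\<^esub> (y [^]\<^bsub>H\<^esub> i) \<in> ?D"
      using E(1) [OF gh] by simp
    then obtain j :: int where j: "h \<otimes>\<^bsub>H\<^esub> inv\<^bsub>H\<^esub> (y [^]\<^bsub>H\<^esub> i) = d [^]\<^bsub>H\<^esub> j"
      using d by auto
    have "h = y [^]\<^bsub>H\<^esub> i \<otimes>\<^bsub>H\<^esub> d [^]\<^bsub>H\<^esub> j"
      using c by (simp add: j [symmetric] H.m_lcomm)
    then have "x = (e, y) [^]\<^bsub>G \<times>\<times> H\<^esub> i \<otimes>\<^bsub>G \<times>\<times> H\<^esub> (\<one>\<^bsub>G\<^esub>, d) [^]\<^bsub>G \<times>\<times> H\<^esub> j"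
      using c by (simp add: pow x i)
    then show "\<exists>(i::int) (j::int). x = (e, y) [^]\<^bsub>G \<times>\<times> H\<^esub> i \<otimes>\<^bsub>G \<times>\<times> H\<^esub> (\<one>\<^bsub>G\<^esub>, d) [^]\<^bsub>G \<times>\<times> H\<^esub> j"
      by blast
  qed
qed

subsection \<open>Subgroups of a cyclic group of prime power order\<close>

text \<open>The index is the exponent of \<open>p\<close> in the order, not in the generator
  \<open>p ^ (a - i)\<close>. For \<open>i > a\<close> truncated subtraction yields the whole
  group.\<close>

definition Zsub :: "nat \<Rightarrow> nat \<Rightarrow> nat \<Rightarrow> int set" where
  "Zsub p a i = {x \<in> {0..<int (p ^ a)}. int (p ^ (a - i)) dvd x}"

context
  fixes p :: nat
  assumes p: "prime p"
begin

private lemma p_gt_1: "p > 1"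
  using p by (rule prime_gt_1_nat)

private lemma p_pos [simp]: "0 < p"
  using p_gt_1 by simp

private lemma p_ne [simp]: "p \<noteq> 0"
  using p_gt_1 by simp

private lemma carrier_Zp: "carrier (Z (p ^ a)) = {0..<int (p ^ a)}"
  by (simp add: carrier_Z)

lemma finite_Zsub [simp]: "finite (Zsub p a i)"
  by (rule finite_subset [of _ "{0..<int (p ^ a)}"]) (auto simp: Zsub_def)

lemma card_Zsub:
  assumes "i \<le> a"
  shows "card (Zsub p a i) = p ^ i"
proof -
  let ?e = "int (p ^ (a - i))"
  have e: "?e > 0" and pa: "int (p ^ a) = ?e * int (p ^ i)"
    using assms p_ne by (simp_all flip: power_add)
  have "bij_betw (\<lambda>k. ?e * k) {0..<int (p ^ i)} (Zsub p a i)"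
  proof (rule bij_betw_imageI)
    show "inj_on (\<lambda>k. ?e * k) {0..<int (p ^ i)}"
      using p_ne by (auto simp: inj_on_def)
    show "(\<lambda>k. ?e * k) ` {0..<int (p ^ i)} = Zsub p a i"
    proof safe
      fix k assume "k \<in> {0..<int (p ^ i)}"
      then show "?e * k \<in> Zsub p a i"
        unfolding Zsub_def pa using e by simp
    next
      fix x assume "x \<in> Zsub p a i"
      then have x: "0 \<le> x" "x < int (p ^ a)" "?e dvd x"
        by (auto simp: Zsub_def)
      then obtain k where k: "x = ?e * k" by blast
      have "0 \<le> k"
        using x(1) e unfolding k zero_le_mult_iff by linarith
      moreover have "k < int (p ^ i)"
        using x(2) e unfolding pa k by simp
      ultimately show "x \<in> (\<lambda>k. ?e * k) ` {0..<int (p ^ i)}"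
        using k by auto
    qed
  qed
  then have "card (Zsub p a i) = card {0..<int (p ^ i)}"
    by (rule bij_betw_same_card [symmetric])
  then show ?thesis by (simp only: card_atLeastLessThan_int diff_zero nat_int)
qed

lemma subgroup_Zsub: "subgroup (Zsub p a i) (Z (p ^ a))"
proof (rule group.subgroupI [OF group_integer_mod_group])
  have d: "int (p ^ (a - i)) dvd int (p ^ a)"
    by (simp add: le_imp_power_dvd)
  show "Zsub p a i \<subseteq> carrier (Z (p ^ a))"
    by (auto simp: Zsub_def carrier_Zp)
  show "Zsub p a i \<noteq> {}"
    using p_ne by (auto simp: Zsub_def intro!: exI [of _ 0])
  fix x assume x: "x \<in> Zsub p a i"
  then show "inv\<^bsub>Z (p ^ a)\<^esub> x \<in> Zsub p a i"
    using d p_ne by (subst inv_integer_mod_group) (auto simp: Zsub_def carrier_Zp dvd_mod_iff)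
  fix y assume "y \<in> Zsub p a i"
  then show "x \<otimes>\<^bsub>Z (p ^ a)\<^esub> y \<in> Zsub p a i"
    using x d p_ne by (auto simp: Zsub_def dvd_mod_iff)
qed

text \<open>A subgroup of order \<open>p ^ i\<close> is killed by \<open>p ^ i\<close>, so its
  elements are multiples of \<open>p ^ (a - i)\<close>. This puts it inside
  \<open>Zsub p a i\<close>, which has the same size.\<close>

lemma subgroup_Z_eq_Zsub:
  assumes A: "subgroup A (Z (p ^ a))"
  obtains i where "i \<le> a" "A = Zsub p a i"
proof -
  have "card (rcosets\<^bsub>Z (p ^ a)\<^esub> A) * card A = p ^ a"
    using group.lagrange [OF group_integer_mod_group A] by (simp add: order_def card_Z)
  then have "card A dvd p ^ a"
    by (metis dvd_triv_right)
  then obtain i where i: "i \<le> a" "card A = p ^ i"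
    using divides_primepow_nat [OF p] by blast
  have "x \<in> Zsub p a i" if "x \<in> A" for x
  proof -
    have "group (Z (p ^ a)\<lparr>carrier := A\<rparr>)"
      using A by (simp add: subgroup.subgroup_is_group)
    then have "x [^]\<^bsub>Z (p ^ a)\<lparr>carrier := A\<rparr>\<^esub> (p ^ i) = 0"
      using group.pow_order_eq_1 [of "Z (p ^ a)\<lparr>carrier := A\<rparr>" x] that i by (simp add: order_def)
    then have "int (p ^ i) * x mod int (p ^ a) = 0"
      using monoid.nat_pow_consistent [OF group.is_monoid [OF group_integer_mod_group [of "p ^ a"]], of x "p ^ i" A]
      by simp
    then have "int (p ^ i) * int (p ^ (a - i)) dvd int (p ^ i) * x"
      using i(1) by (simp add: mod_eq_0_iff_dvd flip: power_add)
    then have "int (p ^ (a - i)) dvd x"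
      using p_ne by simp
    then show ?thesis
      using that subgroup.subset [OF A] by (auto simp: Zsub_def carrier_Zp)
  qed
  then have "A = Zsub p a i"
    using card_Zsub i by (intro card_subset_eq) auto
  then show thesis
    using that i by blast
qed

lemma Zsub_mono: "i \<le> j \<Longrightarrow> Zsub p a i \<subseteq> Zsub p a j"
proof -
  assume "i \<le> j"
  then have "int (p ^ (a - j)) dvd int (p ^ (a - i))"
    by (simp add: le_imp_power_dvd)
  then show ?thesis
    unfolding Zsub_def using dvd_trans by blast
qed

lemma Zsub_subset_iff:
  assumes "i \<le> a" "j \<le> a"
  shows "Zsub p a i \<subseteq> Zsub p a j \<longleftrightarrow> i \<le> j"
proof
  assume "Zsub p a i \<subseteq> Zsub p a j"
  then have "p ^ i \<le> p ^ j"
    using card_mono [OF finite_Zsub] card_Zsub assms by metis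
  then show "i \<le> j"
    using p_gt_1 by simp
qed (rule Zsub_mono)

lemma Zsub_eq_iff: "i \<le> a \<Longrightarrow> j \<le> a \<Longrightarrow> Zsub p a i = Zsub p a j \<longleftrightarrow> i = j"
  using Zsub_subset_iff by (metis antisym order_refl)

lemma cyclic_Zsub: "cyclic_group (Z (p ^ a)\<lparr>carrier := Zsub p a i\<rparr>)"
proof -
  interpret Z: group "Z (p ^ a)" by simp
  interpret A: group "Z (p ^ a)\<lparr>carrier := Zsub p a i\<rparr>"
    using subgroup_Zsub by (simp add: subgroup.subgroup_is_group)
  \<comment> \<open>The reduction matters when \<open>a - i = a\<close>, for instance when
    \<open>i = 0\<close>: the generator must then be the residue 0.\<close>
  define e where "e = int (p ^ (a - i)) mod int (p ^ a)"
  have d: "int (p ^ (a - i)) dvd int (p ^ a)"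
    by (simp add: le_imp_power_dvd)
  have e: "e \<in> Zsub p a i"
    using p_ne d by (auto simp: Zsub_def e_def dvd_mod_iff)
  have "x \<in> range (\<lambda>k::int. e [^]\<^bsub>Z (p ^ a)\<^esub> k)" if "x \<in> Zsub p a i" for x
  proof -
    have x: "0 \<le> x" "x < int (p ^ a)" "int (p ^ (a - i)) dvd x"
      using that by (auto simp: Zsub_def)
    then obtain k where "x = k * int (p ^ (a - i))"
      by (metis dvdE mult.commute)
    then have "x = e [^]\<^bsub>Z (p ^ a)\<^esub> k"
      using x by (simp add: int_pow_integer_mod_group e_def mod_mult_right_eq)
    then show ?thesis by blast
  qed
  moreover have "e [^]\<^bsub>Z (p ^ a)\<^esub> k \<in> Zsub p a i" for k :: int
    using Z.subgroup_int_pow_closed [OF subgroup_Zsub e] .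
  ultimately have "Zsub p a i = range (\<lambda>k::int. e [^]\<^bsub>Z (p ^ a)\<^esub> k)"
    by blast
  then show ?thesis
    using e Z.int_pow_consistent [OF subgroup_Zsub e] by (subst A.cyclic_group) auto
qed

lemma Zsub_exponent_iff:
  assumes "i \<le> a"
  shows "(\<forall>x\<in>Zsub p a i. x [^]\<^bsub>Z (p ^ a)\<^esub> n = 0) \<longleftrightarrow> p ^ i dvd n"
proof -
  have pa: "int (p ^ a) = int (p ^ i) * int (p ^ (a - i))"
    using assms by (simp flip: power_add)
  show ?thesis
  proof
    assume *: "\<forall>x\<in>Zsub p a i. x [^]\<^bsub>Z (p ^ a)\<^esub> n = 0"
    show "p ^ i dvd n"
    \<comment> \<open>The witness is \<open>p ^ (a - i)\<close>, of order exactly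
      \<open>p ^ i\<close>. For \<open>i = 0\<close> it is not a reduced residue, but then the
      divisor is 1.\<close>
    proof (cases "i = 0")
      case False
      then have "int (p ^ (a - i)) \<in> Zsub p a i"
        using assms p_gt_1 by (auto simp: Zsub_def intro!: power_strict_increasing)
      then have "int (p ^ a) dvd int n * int (p ^ (a - i))"
        using * by (auto simp: mod_eq_0_iff_dvd)
      then have "int (p ^ i) dvd int n"
        unfolding pa using p_ne by simp
      then show ?thesis
        by (simp only: of_nat_dvd_iff)
    qed auto
  next
    assume "p ^ i dvd n"
    then have "int (p ^ i) dvd int n"
      by (simp only: of_nat_dvd_iff)
    then show "\<forall>x\<in>Zsub p a i. x [^]\<^bsub>Z (p ^ a)\<^esub> n = 0"
      by (auto simp: Zsub_def mod_eq_0_iff_dvd simp del: of_nat_power) (simp add: pa mult_dvd_mono del: of_nat_power)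
  qed
qed

text \<open>This says that the quotient by \<open>Zsub p a i\<close> has exponent
  \<open>p ^ (a - i)\<close>, phrased without cosets because the exponent of a quotient of the
  product is reduced to conditions of this form.\<close>

lemma Zsub_coexponent_iff:
  assumes "i \<le> a"
  shows "(\<forall>x\<in>carrier (Z (p ^ a)). x [^]\<^bsub>Z (p ^ a)\<^esub> n \<in> Zsub p a i) \<longleftrightarrow> p ^ (a - i) dvd n"
proof -
  have d: "int (p ^ (a - i)) dvd int (p ^ a)"
    by (simp add: le_imp_power_dvd)
  have *: "x [^]\<^bsub>Z (p ^ a)\<^esub> n \<in> Zsub p a i \<longleftrightarrow> int (p ^ (a - i)) dvd int n * x" for x
    using d p_ne by (simp add: Zsub_def dvd_mod_iff)
  show ?thesis
    unfolding *
  proof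
    assume A: "\<forall>x\<in>carrier (Z (p ^ a)). int (p ^ (a - i)) dvd int n * x"
    show "p ^ (a - i) dvd n"
    proof (cases "a = 0")
      case False
      then have "1 \<in> carrier (Z (p ^ a))"
        using p_gt_1 by (simp add: carrier_Zp one_less_power)
      then have "int (p ^ (a - i)) dvd int n"
        using A by fastforce
      then show ?thesis
        by (simp only: of_nat_dvd_iff)
    qed auto
  next
    assume "p ^ (a - i) dvd n"
    then have "int (p ^ (a - i)) dvd int n"
      by (simp only: of_nat_dvd_iff)
    then show "\<forall>x\<in>carrier (Z (p ^ a)). int (p ^ (a - i)) dvd int n * x"
      by simp
  qed
qed

text \<open>A chain is indexed by the exponent \<open>i\<close> of the smaller group and the
  difference \<open>j\<close>, so that \<open>j\<close> describes the quotient. The quotient is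
  cyclic as an image of a cyclic group.\<close>

lemma chain_quot_Zsub:
  assumes "i + j \<le> a"
  shows "(Zsub p a (i + j), Zsub p a i) \<in> subgroup_chains (Z (p ^ a))"
    and "cyclic_group (chain_quot (Z (p ^ a)) (Zsub p a (i + j), Zsub p a i))"
    and "finite (carrier (chain_quot (Z (p ^ a)) (Zsub p a (i + j), Zsub p a i)))"
    and "card (carrier (chain_quot (Z (p ^ a)) (Zsub p a (i + j), Zsub p a i))) = p ^ j"
proof -
  let ?A = "Zsub p a (i + j)" and ?B = "Zsub p a i"
  interpret Z: comm_group "Z (p ^ a)" by simp
  show ch: "(?A, ?B) \<in> subgroup_chains (Z (p ^ a))"
    using subgroup_Zsub Zsub_mono by (auto simp: subgroup_chains_def)
  note F = Z.chain_quot_facts [OF ch]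
  interpret A: group "Z (p ^ a)\<lparr>carrier := ?A\<rparr>" by (rule F)
  interpret N: normal ?B "Z (p ^ a)\<lparr>carrier := ?A\<rparr>" by (rule F)
  have "(\<lambda>x. ?B #>\<^bsub>Z (p ^ a)\<^esub> x) \<in> epi (Z (p ^ a)\<lparr>carrier := ?A\<rparr>) (chain_quot (Z (p ^ a)) (?A, ?B))"
    using group_hom.homh [OF F(4)] F(5) by (simp add: epi_def)
  then show "cyclic_group (chain_quot (Z (p ^ a)) (?A, ?B))"
    by (rule A.cyclic_group_epimorphic_image [OF _ cyclic_Zsub comm_group.axioms(2) [OF F(1)]])
  show "finite (carrier (chain_quot (Z (p ^ a)) (?A, ?B)))"
    by (simp add: F(5))
  have "card (carrier (chain_quot (Z (p ^ a)) (?A, ?B))) * card ?B = card ?A"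
    using A.lagrange [OF N.subgroup_axioms]
    by (simp add: order_def chain_quot_def FactGroup_def)
  then show "card (carrier (chain_quot (Z (p ^ a)) (?A, ?B))) = p ^ j"
    using assms p_ne by (simp add: card_Zsub power_add)
qed

lemma chains_Z_eq_Zsub:
  assumes "(A, B) \<in> subgroup_chains (Z (p ^ a))"
  obtains i j where "i + j \<le> a" "A = Zsub p a (i + j)" "B = Zsub p a i"
proof -
  have "subgroup A (Z (p ^ a))" "subgroup B (Z (p ^ a))" "B \<subseteq> A"
    using assms by (auto simp: subgroup_chains_def)
  then obtain i k where "i \<le> a" "k \<le> a" "A = Zsub p a k" "B = Zsub p a i" "i \<le> k"
    by (metis subgroup_Z_eq_Zsub Zsub_subset_iff)
  then show thesis
    using that [of i "k - i"] by simp
qed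

end

section \<open>Transport of subgroups and quotients along an isomorphism\<close>

lemma (in group) bij_betw_subgroups:
  assumes f: "f \<in> iso G H" and "group H"
  shows "bij_betw (image f) {K. subgroup K G} {L. subgroup L H}"
proof -
  have inj: "inj_on f (carrier G)" and im: "f ` carrier G = carrier H"
    using f by (auto simp: iso_iff)
  let ?g = "inv_into (carrier G) f"
  have g: "?g \<in> iso H G"
    using iso_set_sym [OF f] .
  have "f ` ?g ` L = L" if "subgroup L H" for L
    using image_inv_into_cancel [OF im subgroup.subset [OF that]] .
  moreover have "subgroup (f ` K) H" if "subgroup K G" for K
    using subgroup.iso_subgroup [OF that group_axioms \<open>group H\<close> f] .
  moreover have "subgroup (?g ` L) G" if "subgroup L H" for L
    using subgroup.iso_subgroup [OF that \<open>group H\<close> group_axioms g] .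
  moreover have "inj_on (image f) {K. subgroup K G}"
    using inj_on_image_Pow [OF inj] by (rule inj_on_subset) (auto dest: subgroup.subset)
  ultimately show ?thesis
    by (auto simp: bij_betw_def image_iff) metis
qed

lemma (in comm_group) FactGroup_image_iso:
  assumes f: "f \<in> iso G H" and H: "comm_group H" and K: "subgroup K G"
  shows "G Mod K \<cong> H Mod (f ` K)"
proof -
  interpret H: comm_group H by fact
  have inj: "inj_on f (carrier G)" and im: "f ` carrier G = carrier H" and hom: "f \<in> hom G H"
    using f by (auto simp: iso_iff)
  have fK: "subgroup (f ` K) H"
    using subgroup.iso_subgroup [OF K group_axioms H.group_axioms f] .
  interpret N: normal "f ` K" H
    using H.subgroup_imp_normal [OF fK] .
  let ?q = "\<lambda>x. (f ` K) #>\<^bsub>H\<^esub> f x"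
  have "(\<lambda>x. (f ` K) #>\<^bsub>H\<^esub> x) \<circ> f \<in> hom G (H Mod (f ` K))"
    by (rule Group.hom_compose [OF hom N.r_coset_hom_Mod])
  then interpret q: group_hom G "H Mod (f ` K)" ?q
    by (simp add: group_hom_def group_hom_axioms_def N.factorgroup_is_group o_def)
  have "?q x = f ` K \<longleftrightarrow> x \<in> K" if "x \<in> carrier G" for x
  proof -
    have fx: "f x \<in> carrier H" using hom that by (auto simp: hom_def)
    have "?q x = f ` K \<longleftrightarrow> f x \<in> f ` K"
      using H.coset_join1 [OF _ fx fK] H.coset_join2 [OF fx fK] by blast
    also have "\<dots> \<longleftrightarrow> x \<in> K"
      using inj that subgroup.subset [OF K] by (simp add: inj_on_image_mem_iff)
    finally show ?thesis .
  qed
  then have "kernel G (H Mod (f ` K)) ?q = K"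
    using subgroup.subset [OF K] by (auto simp: kernel_def)
  moreover have "?q ` carrier G = carrier (H Mod (f ` K))"
    by (simp add: carrier_FactGroup im [symmetric] image_image)
  ultimately show ?thesis
    using q.FactGroup_iso by simp
qed

subsection \<open>Types of subgroups and quotients of a rank two group\<close>

text \<open>
  The quintuple of a subgroup with Goursat data \<open>((A, B), (C, D))\<close> in \<open>G = Z(p^a)\<close> and
  \<open>H = Z(p^b)\<close> consists of the exponents of \<open>p\<close> in \<open>|B|\<close>, \<open>|G/A|\<close>, \<open>|A/B| = |C/D|\<close>, \<open>|D|\<close>
  and \<open>|H/C|\<close>.
\<close>

type_synonym quint = "nat \<times> nat \<times> nat \<times> nat \<times> nat"

definition ZP :: "nat \<Rightarrow> nat \<times> nat \<Rightarrow> (int \<times> int) monoid" where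
  "ZP p t = Z (p ^ fst t) \<times>\<times> Z (p ^ snd t)"

definition quints :: "nat \<times> nat \<Rightarrow> quint set" where
  "quints t = {(x1, x2, x3, x4, x5). x1 + x2 + x3 = fst t \<and> x3 + x4 + x5 = snd t}"

fun mid :: "quint \<Rightarrow> nat" where "mid (x1, x2, x3, x4, x5) = x3"

fun sub_exp :: "quint \<Rightarrow> nat" where "sub_exp (x1, x2, x3, x4, x5) = x1 + x3 + x4"

text \<open>The two projections of the subgroup are cyclic of orders \<open>p ^ (x1 + x3)\<close>
  and \<open>p ^ (x4 + x3)\<close>; the larger is its exponent. What remains of its order
  \<open>p ^ (x1 + x3 + x4)\<close> is the smaller factor.\<close>

fun sub_type :: "quint \<Rightarrow> nat \<times> nat" where
  "sub_type (x1, x2, x3, x4, x5) = (min x1 x4, x3 + max x1 x4)"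

text \<open>The same computation for the quotient, with the indices \<open>p ^ (x2 + x3)\<close> of
  \<open>B\<close> and \<open>p ^ (x5 + x3)\<close> of \<open>D\<close> in place of the orders of
  the projections.\<close>

fun factor_type :: "quint \<Rightarrow> nat \<times> nat" where
  "factor_type (x1, x2, x3, x4, x5) = (min x2 x5, x3 + max x2 x5)"

lemma finite_quints: "finite (quints t)"
proof -
  let ?R = "{..fst t + snd t}"
  have "quints t \<subseteq> ?R \<times> ?R \<times> ?R \<times> ?R \<times> ?R"
    by (auto simp: quints_def)
  then show ?thesis
    by (rule finite_subset) (intro finite_cartesian_product finite_atMost)
qed

lemma group_ZP: "group (ZP p t)"
  by (simp add: ZP_def group_ZZ)

lemma comm_group_ZP: "comm_group (ZP p t)"
  by (simp add: ZP_def comm_group_ZZ)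

lemma finite_ZP: "prime p \<Longrightarrow> finite (carrier (ZP p t))"
  unfolding ZP_def by (rule finite_ZZ) (simp_all add: prime_gt_0_nat)

lemma ZP_iso_unique:
  assumes "prime p" "fst t \<le> snd t" "fst t' \<le> snd t'" "ZP p t \<cong> ZP p t'"
  shows "t = t'"
  using ZZ_iso_unique [OF assms(1-3)] assms(4) by (simp add: ZP_def prod_eq_iff)

section \<open>Goursat data in a product of two cyclic p-groups\<close>

definition quint_data :: "nat \<Rightarrow> nat \<Rightarrow> nat \<Rightarrow> quint \<Rightarrow> (int set \<times> int set) \<times> (int set \<times> int set)" where
  "quint_data p a b = (\<lambda>(x1, x2, x3, x4, x5).
     ((Zsub p a (x1 + x3), Zsub p a x1), (Zsub p b (x4 + x3), Zsub p b x4)))"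

context
  fixes p a b :: nat
  assumes p: "prime p"
begin

interpretation two_comm_groups "Z (p ^ a)" "Z (p ^ b)"
  by (simp add: two_comm_groups_def)

private lemma fin: "finite (carrier (Z (p ^ a)))" "finite (carrier (Z (p ^ b)))"
  using p by (simp_all add: finite_Z prime_gt_0_nat)

text \<open>Distinct exponents give distinct groups \<open>Zsub\<close>, which fixes
  \<open>x1\<close>, \<open>x3\<close> and \<open>x4\<close>; the sums \<open>a\<close> and
  \<open>b\<close> then fix \<open>x2\<close> and \<open>x5\<close>.\<close>

lemma quint_data_inj: "inj_on (quint_data p a b) (quints (a, b))"
proof (rule inj_onI)
  fix x y
  assume xy: "x \<in> quints (a, b)" "y \<in> quints (a, b)" "quint_data p a b x = quint_data p a b y"
  obtain x1 x2 x3 x4 x5 where x: "x = (x1, x2, x3, x4, x5)" by (metis surj_pair)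
  obtain y1 y2 y3 y4 y5 where y: "y = (y1, y2, y3, y4, y5)" by (metis surj_pair)
  have s: "x1 + x2 + x3 = a" "x3 + x4 + x5 = b" "y1 + y2 + y3 = a" "y3 + y4 + y5 = b"
    using xy by (auto simp: x y quints_def)
  have "x1 + x3 = y1 + y3" "x1 = y1" "x4 = y4"
    using xy(3) s by (auto simp: x y quint_data_def Zsub_eq_iff [OF p])
  then show "x = y"
    using s by (auto simp: x y)
qed

text \<open>The subgroup comes from an isomorphism of its two quotients, so these have equal order.
  This is why one middle entry serves both factors.\<close>

lemma goursat_in_quint_data:
  assumes K: "subgroup K (Z (p ^ a) \<times>\<times> Z (p ^ b))"
  shows "goursat (Z (p ^ a)) (Z (p ^ b)) K \<in> quint_data p a b ` quints (a, b)"
proof -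
  obtain A B C D where data: "goursat (Z (p ^ a)) (Z (p ^ b)) K = ((A, B), (C, D))"
    by (metis surj_pair)
  then have AB: "(A, B) \<in> subgroup_chains (Z (p ^ a))" and CD: "(C, D) \<in> subgroup_chains (Z (p ^ b))"
    using goursat_chains [OF K] by auto
  obtain i j where ij: "i + j \<le> a" "A = Zsub p a (i + j)" "B = Zsub p a i"
    using chains_Z_eq_Zsub [OF p AB] .
  obtain k l where kl: "k + l \<le> b" "C = Zsub p b (k + l)" "D = Zsub p b k"
    using chains_Z_eq_Zsub [OF p CD] .
  obtain \<theta> where "\<theta> \<in> isos (chain_quot (Z (p ^ a)) (A, B)) (chain_quot (Z (p ^ b)) (C, D))"
    using goursat_graph_surj [OF AB CD K data] by blast
  then have "p ^ j = p ^ l"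
    using chain_quot_Zsub(4) [OF p ij(1)] chain_quot_Zsub(4) [OF p kl(1)] ij kl
    by (auto simp: isos_def iso_def dest: bij_betw_same_card)
  then have "j = l"
    using prime_gt_1_nat [OF p] by simp
  then show ?thesis
    using ij kl
    by (intro image_eqI [of _ _ "(i, a - (i + j), j, k, b - (k + j))"])
      (auto simp: data quint_data_def quints_def)
qed

lemma card_quint_data_fiber:
  assumes "x \<in> quints (a, b)"
  shows "card {K. subgroup K (Z (p ^ a) \<times>\<times> Z (p ^ b)) \<and>
    goursat (Z (p ^ a)) (Z (p ^ b)) K = quint_data p a b x} = totient (p ^ mid x)"
proof -
  obtain x1 x2 x3 x4 x5 where x: "x = (x1, x2, x3, x4, x5)"
    by (metis surj_pair)
  have le: "x1 + x3 \<le> a" "x4 + x3 \<le> b"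
    using assms by (auto simp: x quints_def)
  note X = chain_quot_Zsub [OF p le(1)] and Y = chain_quot_Zsub [OF p le(2)]
  show ?thesis
    unfolding x quint_data_def prod.case card_goursat_fiber [OF X(1) Y(1)] mid.simps
    by (rule card_isos_cyclic [OF _ X(2-4) _ Y(2-4)])
      (use G.chain_quot_facts(1) [OF X(1)] H.chain_quot_facts(1) [OF Y(1)] in
        \<open>auto dest: comm_group.axioms(2)\<close>)
qed

context
  fixes K x1 x2 x3 x4 x5
  assumes K: "subgroup K (Z (p ^ a) \<times>\<times> Z (p ^ b))"
    and x: "(x1, x2, x3, x4, x5) \<in> quints (a, b)"
    and data: "goursat (Z (p ^ a)) (Z (p ^ b)) K = quint_data p a b (x1, x2, x3, x4, x5)"
begin

private lemma components:
  "fst ` K = Zsub p a (x1 + x3)" "{g. (g, 0) \<in> K} = Zsub p a x1"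
  "snd ` K = Zsub p b (x4 + x3)" "{h. (0, h) \<in> K} = Zsub p b x4"
  using data by (auto simp: goursat_def quint_data_def)

private lemma sums: "x1 + x2 + x3 = a" "x3 + x4 + x5 = b"
  using x by (auto simp: quints_def)

interpretation P: comm_group "Z (p ^ a) \<times>\<times> Z (p ^ b)"
  by (rule comm_group_ZZ)

interpretation K: subgroup K "Z (p ^ a) \<times>\<times> Z (p ^ b)"
  by (rule K)

lemma card_of_quint: "card K = p ^ (x1 + x3 + x4)"
  using card_subgroup_prod [OF K fin] components sums
  by (simp add: card_Zsub [OF p] power_add)

text \<open>A power kills \<open>K\<close> if and only if it kills both projections. These are
  cyclic of known order, which gives the exponent; the order of \<open>K\<close> and its two
  generators are known already.\<close>

lemma subgroup_type_of_quint:
  "(Z (p ^ a) \<times>\<times> Z (p ^ b))\<lparr>carrier := K\<rparr> \<cong> Z (p ^ min x1 x4) \<times>\<times> Z (p ^ (x3 + max x1 x4))"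
    (is "?K \<cong> _")
proof -
  interpret K': comm_group ?K
    by (rule group.group_comm_groupI [OF K.subgroup_is_group [OF P.group_axioms]])
      (use K.mem_carrier P.m_comm in auto)
  obtain g h where gh: "g \<in> K" "h \<in> K"
    and gen: "\<And>x. x \<in> K \<Longrightarrow> \<exists>(i::int) (j::int).
      x = g [^]\<^bsub>Z (p ^ a) \<times>\<times> Z (p ^ b)\<^esub> i \<otimes>\<^bsub>Z (p ^ a) \<times>\<times> Z (p ^ b)\<^esub> h [^]\<^bsub>Z (p ^ a) \<times>\<times> Z (p ^ b)\<^esub> j"
    by (rule subgroup_prod_generators [OF K]) (use components cyclic_Zsub [OF p] in auto)
  show ?thesis
  proof (rule K'.iso_ZZ [OF p, of _ _ g h])
    show "\<exists>(i::int) (j::int). x = g [^]\<^bsub>?K\<^esub> i \<otimes>\<^bsub>?K\<^esub> h [^]\<^bsub>?K\<^esub> j" if "x \<in> carrier ?K" for x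
      using gen [of x] that by (simp flip: P.int_pow_consistent [OF K gh(1)] P.int_pow_consistent [OF K gh(2)])
    have e: "min x1 x4 + (x3 + max x1 x4) = x1 + x3 + x4"
      by (simp add: min_def max_def)
    show "card (carrier ?K) = p ^ (min x1 x4 + (x3 + max x1 x4))"
      unfolding e using card_of_quint by simp
    fix n :: nat
    have "(\<forall>x\<in>K. x [^]\<^bsub>?K\<^esub> n = \<one>\<^bsub>?K\<^esub>) \<longleftrightarrow>
      (\<forall>g\<in>fst ` K. g [^]\<^bsub>Z (p ^ a)\<^esub> n = 0) \<and> (\<forall>h\<in>snd ` K. h [^]\<^bsub>Z (p ^ b)\<^esub> n = 0)"
      by (force simp: pow_DirProd simp del: pow_integer_mod_group simp flip: P.nat_pow_consistent)
    also have "\<dots> \<longleftrightarrow> p ^ (x1 + x3) dvd n \<and> p ^ (x4 + x3) dvd n"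
      using sums by (simp add: components Zsub_exponent_iff [OF p] del: pow_integer_mod_group)
    also have "\<dots> \<longleftrightarrow> p ^ (x3 + max x1 x4) dvd n"
      by (cases "x1 \<le> x4") (auto simp: max_def add.commute intro: power_le_dvd)
    finally show "(\<forall>x\<in>carrier ?K. x [^]\<^bsub>?K\<^esub> n = \<one>\<^bsub>?K\<^esub>) \<longleftrightarrow> p ^ (x3 + max x1 x4) dvd n"
      by simp
  qed (use gh in auto)
qed

text \<open>All \<open>n\<close>-th powers lie in \<open>K\<close> if and only if this holds for
  elements supported on a single coordinate, so the exponent of the quotient depends only on the
  intersections of \<open>K\<close> with the two factors.\<close>

lemma quotient_type_of_quint:
  "(Z (p ^ a) \<times>\<times> Z (p ^ b)) Mod K \<cong> Z (p ^ min x2 x5) \<times>\<times> Z (p ^ (x3 + max x2 x5))"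
    (is "?P Mod K \<cong> _")
proof -
  interpret N: normal K ?P
    by (rule P.subgroup_imp_normal [OF K])
  interpret Q: comm_group "?P Mod K"
    by (rule P.abelian_FactGroup [OF K])
  obtain e where e: "e \<in> carrier (Z (p ^ a))" "carrier (Z (p ^ a)) = range (\<lambda>i::int. e [^]\<^bsub>Z (p ^ a)\<^esub> i)"
    using iffD1 [OF G.cyclic_group cyclic_Z] by (rule bexE)
  obtain d where d: "d \<in> carrier (Z (p ^ b))" "carrier (Z (p ^ b)) = range (\<lambda>i::int. d [^]\<^bsub>Z (p ^ b)\<^esub> i)"
    using iffD1 [OF H.cyclic_group cyclic_Z] by (rule bexE)
  show ?thesis
  proof (rule Q.iso_ZZ [OF p, of _ _ "K #>\<^bsub>?P\<^esub> (e, 0)" "K #>\<^bsub>?P\<^esub> (0, d)"])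
    have "e \<in> carrier (Z (p ^ a))" "d \<in> carrier (Z (p ^ b))" by fact+
    then have ed: "(e, 0) \<in> carrier ?P" "(0, d) \<in> carrier ?P" by simp_all
    then show "K #>\<^bsub>?P\<^esub> (e, 0) \<in> carrier (?P Mod K)" "K #>\<^bsub>?P\<^esub> (0, d) \<in> carrier (?P Mod K)"
      unfolding carrier_FactGroup by blast+
    show "\<exists>(i::int) (j::int). X = (K #>\<^bsub>?P\<^esub> (e, 0)) [^]\<^bsub>?P Mod K\<^esub> i \<otimes>\<^bsub>?P Mod K\<^esub> (K #>\<^bsub>?P\<^esub> (0, d)) [^]\<^bsub>?P Mod K\<^esub> j"
      if X: "X \<in> carrier (?P Mod K)" for X
    proof -
      obtain g h where gh: "g \<in> carrier (Z (p ^ a))" "h \<in> carrier (Z (p ^ b))" "X = K #>\<^bsub>?P\<^esub> (g, h)"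
        using X unfolding carrier_FactGroup by auto
      obtain i :: int where i: "g = e [^]\<^bsub>Z (p ^ a)\<^esub> i" using gh e by blast
      obtain j :: int where j: "h = d [^]\<^bsub>Z (p ^ b)\<^esub> j" using gh d by blast
      have "(g, h) = (e, 0) [^]\<^bsub>?P\<^esub> i \<otimes>\<^bsub>?P\<^esub> (0, d) [^]\<^bsub>?P\<^esub> j"
        using ed by (simp add: int_pow_DirProd int_pow_integer_mod_group i j)
      then have "X = (K #>\<^bsub>?P\<^esub> (e, 0)) [^]\<^bsub>?P Mod K\<^esub> i \<otimes>\<^bsub>?P Mod K\<^esub> (K #>\<^bsub>?P\<^esub> (0, d)) [^]\<^bsub>?P Mod K\<^esub> j"
        using ed by (simp add: gh N.FactGroup_int_pow N.rcos_sum del: carrier_DirProd mult_DirProd)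
      then show ?thesis by blast
    qed
    have "card (carrier (?P Mod K)) * card K = p ^ (a + b)"
      using P.lagrange [OF K] p
      by (simp add: order_def FactGroup_def card_ZZ prime_gt_0_nat power_add del: carrier_DirProd)
    moreover have "a + b = (min x2 x5 + (x3 + max x2 x5)) + (x1 + x3 + x4)"
      using sums by (simp add: min_def max_def)
    ultimately show "card (carrier (?P Mod K)) = p ^ (min x2 x5 + (x3 + max x2 x5))"
      using prime_gt_0_nat [OF p] by (simp add: card_of_quint power_add)
    fix n :: nat
    have "(\<forall>X\<in>carrier (?P Mod K). X [^]\<^bsub>?P Mod K\<^esub> n = \<one>\<^bsub>?P Mod K\<^esub>) \<longleftrightarrow>
      (\<forall>x\<in>carrier ?P. x [^]\<^bsub>?P\<^esub> n \<in> K)"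
    proof -
      have "(K #>\<^bsub>?P\<^esub> x) [^]\<^bsub>?P Mod K\<^esub> n = K \<longleftrightarrow> x [^]\<^bsub>?P\<^esub> n \<in> K" if "x \<in> carrier ?P" for x
        unfolding N.FactGroup_pow [OF that]
        using P.coset_join1 [OF _ _ K] P.coset_join2 [OF _ K] P.nat_pow_closed [OF that] by blast
      then show ?thesis
        unfolding carrier_FactGroup one_FactGroup by blast
    qed
    \<comment> \<open>One direction specialises a coordinate to 0; the other adds the two
      one-coordinate powers inside \<open>K\<close>.\<close>
    also have "\<dots> \<longleftrightarrow> (\<forall>g\<in>carrier (Z (p ^ a)). g [^]\<^bsub>Z (p ^ a)\<^esub> n \<in> Zsub p a x1) \<and>
      (\<forall>h\<in>carrier (Z (p ^ b)). h [^]\<^bsub>Z (p ^ b)\<^esub> n \<in> Zsub p b x4)" (is "?l \<longleftrightarrow> ?r1 \<and> ?r2")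
    proof
      assume l: ?l
      have "(g, 0) [^]\<^bsub>?P\<^esub> n \<in> K" if "g \<in> carrier (Z (p ^ a))" for g
        using l that by simp
      moreover have "(0, h) [^]\<^bsub>?P\<^esub> n \<in> K" if "h \<in> carrier (Z (p ^ b))" for h
        using l that by simp
      ultimately show "?r1 \<and> ?r2"
        by (auto simp: pow_DirProd simp flip: components)
    next
      assume "?r1 \<and> ?r2"
      then have r: "(g [^]\<^bsub>Z (p ^ a)\<^esub> n, 0) \<in> K" "(0, h [^]\<^bsub>Z (p ^ b)\<^esub> n) \<in> K"
        if "g \<in> carrier (Z (p ^ a))" "h \<in> carrier (Z (p ^ b))" for g h
        using that components by blast+
      show ?l
      proof
        fix x assume "x \<in> carrier ?P"
        then obtain g h where x: "x = (g, h)" and gh: "g \<in> carrier (Z (p ^ a))" "h \<in> carrier (Z (p ^ b))"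
          by auto
        have "(g [^]\<^bsub>Z (p ^ a)\<^esub> n, 0) \<otimes>\<^bsub>?P\<^esub> (0, h [^]\<^bsub>Z (p ^ b)\<^esub> n) \<in> K"
          using K.m_closed [OF r] gh by blast
        then show "x [^]\<^bsub>?P\<^esub> n \<in> K"
          by (simp add: x pow_DirProd)
      qed
    qed
    also have "\<dots> \<longleftrightarrow> p ^ (a - x1) dvd n \<and> p ^ (b - x4) dvd n"
      using Zsub_coexponent_iff [OF p, of x1 a n] Zsub_coexponent_iff [OF p, of x4 b n] sums by simp
    also have "a - x1 = x2 + x3"
      using sums by simp
    also have "b - x4 = x5 + x3"
      using sums by simp
    also have "p ^ (x2 + x3) dvd n \<and> p ^ (x5 + x3) dvd n \<longleftrightarrow> p ^ (x3 + max x2 x5) dvd n"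
      by (cases "x2 \<le> x5") (auto simp: max_def add.commute intro: power_le_dvd)
    finally show "(\<forall>X\<in>carrier (?P Mod K). X [^]\<^bsub>?P Mod K\<^esub> n = \<one>\<^bsub>?P Mod K\<^esub>) \<longleftrightarrow>
      p ^ (x3 + max x2 x5) dvd n" .
  qed auto
qed

end

end

section \<open>Subgroups and chains in an abelian p-group of rank at most two\<close>

text \<open>The group is known only up to isomorphism, so that this applies both to the full product
  and to each of its subgroups. The labelling \<open>\<tau>\<close> depends on a chosen isomorphism,
  but the listed properties are all that is used of it.\<close>

lemma rank_two_subgroups:
  assumes p: "prime p" and "comm_group G" and iso: "G \<cong> ZP p t"
  obtains \<tau> :: "'a set \<Rightarrow> quint" where
    "\<And>K. subgroup K G \<Longrightarrow> \<tau> K \<in> quints t"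
    "\<And>K. subgroup K G \<Longrightarrow> card K = p ^ sub_exp (\<tau> K)"
    "\<And>K. subgroup K G \<Longrightarrow> G\<lparr>carrier := K\<rparr> \<cong> ZP p (sub_type (\<tau> K))"
    "\<And>K. subgroup K G \<Longrightarrow> G Mod K \<cong> ZP p (factor_type (\<tau> K))"
    "\<And>x. x \<in> quints t \<Longrightarrow> card {K. subgroup K G \<and> \<tau> K = x} = totient (p ^ mid x)"
proof -
  interpret comm_group G by fact
  obtain a b where t: "t = (a, b)" by (cases t)
  let ?P = "Z (p ^ a) \<times>\<times> Z (p ^ b)"
  have P: "comm_group ?P" "group ?P"
    by (simp_all add: comm_group_ZZ group_ZZ)
  obtain f where f: "f \<in> iso G ?P"
    using iso by (auto simp: is_iso_def ZP_def t)
  have inj: "inj_on f (carrier G)"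
    using f by (auto simp: iso_iff)
  \<comment> \<open>\<open>inv_into\<close> is meaningful here only when \<open>K\<close> is a
    subgroup, since then its Goursat data lie in the image of \<open>quint_data\<close>.\<close>
  define \<tau> where
    "\<tau> K = inv_into (quints t) (quint_data p a b) (goursat (Z (p ^ a)) (Z (p ^ b)) (f ` K))" for K
  have bij: "bij_betw (image f) {K. subgroup K G} {L. subgroup L ?P}"
    by (rule bij_betw_subgroups [OF f P(2)])
  have fK: "subgroup (f ` K) ?P" if "subgroup K G" for K
    using bij that by (auto simp: bij_betw_def)
  have \<tau>: "\<tau> K \<in> quints (a, b)" "goursat (Z (p ^ a)) (Z (p ^ b)) (f ` K) = quint_data p a b (\<tau> K)"
    if "subgroup K G" for K
    using inv_into_into [OF goursat_in_quint_data [OF p fK [OF that]]]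
      f_inv_into_f [OF goursat_in_quint_data [OF p fK [OF that]]]
    by (simp_all add: \<tau>_def t)
  have facts: "card K = p ^ sub_exp (\<tau> K) \<and> G\<lparr>carrier := K\<rparr> \<cong> ZP p (sub_type (\<tau> K)) \<and>
      G Mod K \<cong> ZP p (factor_type (\<tau> K))" if K: "subgroup K G" for K
  proof -
    obtain x1 x2 x3 x4 x5 where x: "\<tau> K = (x1, x2, x3, x4, x5)"
      by (metis surj_pair)
    note \<tau>' = \<tau> [OF K, unfolded x]
    have "card (f ` K) = card K"
      by (rule card_image [OF inj_on_subset [OF inj subgroup.subset [OF K]]])
    moreover have "G\<lparr>carrier := K\<rparr> \<cong> ?P\<lparr>carrier := f ` K\<rparr>"
      using iso_restrict [OF f group_axioms P(2) K] by (rule is_isoI)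
    moreover have "G Mod K \<cong> ?P Mod (f ` K)"
      by (rule FactGroup_image_iso [OF f P(1) K])
    ultimately show ?thesis
      using card_of_quint [OF p fK [OF K] \<tau>']
        iso_trans [OF _ subgroup_type_of_quint [OF p fK [OF K] \<tau>']]
        iso_trans [OF _ quotient_type_of_quint [OF p fK [OF K] \<tau>']]
      unfolding x sub_type.simps factor_type.simps sub_exp.simps ZP_def fst_conv snd_conv
      by metis
  qed
  show thesis
  proof
    show "card {K. subgroup K G \<and> \<tau> K = x} = totient (p ^ mid x)" if x: "x \<in> quints t" for x
    proof -
      have eq: "\<tau> K = x \<longleftrightarrow> goursat (Z (p ^ a)) (Z (p ^ b)) (f ` K) = quint_data p a b x"
        if "subgroup K G" for K
        using \<tau> [OF that] x inj_on_eq_iff [OF quint_data_inj [OF p], of "\<tau> K" a b x] by (auto simp: t)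
      have "bij_betw (image f) {K. subgroup K G \<and> \<tau> K = x}
        {L. subgroup L ?P \<and> goursat (Z (p ^ a)) (Z (p ^ b)) L = quint_data p a b x}"
      proof (rule bij_betw_subset [OF bij])
        show "image f ` {K. subgroup K G \<and> \<tau> K = x} =
          {L. subgroup L ?P \<and> goursat (Z (p ^ a)) (Z (p ^ b)) L = quint_data p a b x}"
        proof (intro equalityI subsetI)
          fix L assume L: "L \<in> {L. subgroup L ?P \<and> goursat (Z (p ^ a)) (Z (p ^ b)) L = quint_data p a b x}"
          then have "L \<in> image f ` {K. subgroup K G}"
            using bij_betw_imp_surj_on [OF bij] by simp
          then obtain K where K: "subgroup K G" "L = f ` K"
            by blast
          then show "L \<in> image f ` {K. subgroup K G \<and> \<tau> K = x}"
            using L eq [OF K(1)] by auto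
        qed (use fK eq in auto)
      qed auto
      then show ?thesis
        using card_quint_data_fiber [OF p, of x a b] x by (simp add: t bij_betw_same_card)
    qed
  qed (use \<tau> facts in \<open>auto simp: t\<close>)
qed

text \<open>The first quintuple describes \<open>A\<close> in the group. The second describes
  \<open>B\<close> in \<open>A\<close>, so it is bound by the type of \<open>A\<close>.\<close>

definition quint_pairs :: "nat \<times> nat \<Rightarrow> (quint \<times> quint) set" where
  "quint_pairs t = (SIGMA x:quints t. quints (sub_type x))"

lemma finite_quint_pairs: "finite (quint_pairs t)"
  by (simp add: quint_pairs_def finite_quints)

lemma finite_subgroups: "finite (carrier G) \<Longrightarrow> finite {K. subgroup K G}"
  by (rule finite_subset [of _ "Pow (carrier G)"]) (auto dest: subgroup.subset)

lemma finite_chains: "finite (carrier G) \<Longrightarrow> finite (subgroup_chains G)"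
  by (rule finite_subset [of _ "{K. subgroup K G} \<times> {K. subgroup K G}"])
    (auto simp: subgroup_chains_def finite_subgroups)

lemma (in group) subgroup_of_subgroup_iff:
  assumes "subgroup A G"
  shows "subgroup B (G\<lparr>carrier := A\<rparr>) \<longleftrightarrow> subgroup B G \<and> B \<subseteq> A"
  using incl_subgroup [OF assms] subgroup_incl [OF _ assms] subgroup.subset by fastforce

text \<open>A chain is a subgroup \<open>A\<close> together with a subgroup \<open>B\<close> of
  \<open>A\<close>. The number of \<open>B\<close> with a given label depends on \<open>A\<close>
  only through the label of \<open>A\<close>, so class sizes multiply.\<close>

lemma rank_two_chains:
  assumes p: "prime p" and "comm_group G" and iso: "G \<cong> ZP p t"
  obtains \<sigma> :: "'a set \<times> 'a set \<Rightarrow> quint \<times> quint" where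
    "\<And>P. P \<in> subgroup_chains G \<Longrightarrow> \<sigma> P \<in> quint_pairs t"
    "\<And>P. P \<in> subgroup_chains G \<Longrightarrow> card (fst P) = p ^ sub_exp (fst (\<sigma> P))"
    "\<And>P. P \<in> subgroup_chains G \<Longrightarrow> card (snd P) = p ^ sub_exp (snd (\<sigma> P))"
    "\<And>P. P \<in> subgroup_chains G \<Longrightarrow> chain_quot G P \<cong> ZP p (factor_type (snd (\<sigma> P)))"
    "\<And>w. w \<in> quint_pairs t \<Longrightarrow> card {P \<in> subgroup_chains G. \<sigma> P = w} =
      totient (p ^ mid (fst w)) * totient (p ^ mid (snd w))"
proof -
  interpret comm_group G by fact
  have fin: "finite (carrier G)"
    using iso_finite [OF iso] finite_ZP [OF p] by blast
  obtain \<tau> where \<tau>: "\<And>K. subgroup K G \<Longrightarrow> \<tau> K \<in> quints t"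
    "\<And>K. subgroup K G \<Longrightarrow> card K = p ^ sub_exp (\<tau> K)"
    "\<And>K. subgroup K G \<Longrightarrow> G\<lparr>carrier := K\<rparr> \<cong> ZP p (sub_type (\<tau> K))"
    "\<And>K. subgroup K G \<Longrightarrow> G Mod K \<cong> ZP p (factor_type (\<tau> K))"
    "\<And>x. x \<in> quints t \<Longrightarrow> card {K. subgroup K G \<and> \<tau> K = x} = totient (p ^ mid x)"
    by (rule rank_two_subgroups [OF p \<open>comm_group G\<close> iso]) (rule that)
  \<comment> \<open>\<open>Q\<close> bundles the specification of a labelling of the subgroups of
    \<open>A\<close>, so that one labelling can be chosen for all \<open>A\<close>
    simultaneously.\<close>
  define Q where "Q A \<rho> \<longleftrightarrow>
    (\<forall>B. subgroup B (G\<lparr>carrier := A\<rparr>) \<longrightarrow> \<rho> B \<in> quints (sub_type (\<tau> A)) \<and>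
      card B = p ^ sub_exp (\<rho> B) \<and> G\<lparr>carrier := A\<rparr> Mod B \<cong> ZP p (factor_type (\<rho> B))) \<and>
    (\<forall>y\<in>quints (sub_type (\<tau> A)).
      card {B. subgroup B (G\<lparr>carrier := A\<rparr>) \<and> \<rho> B = y} = totient (p ^ mid y))" for A \<rho>
  have "\<exists>\<rho>. Q A \<rho>" if A: "subgroup A G" for A
  proof -
    have cg: "comm_group (G\<lparr>carrier := A\<rparr>)"
      by (rule group.group_comm_groupI [OF subgroup.subgroup_is_group [OF A group_axioms]])
        (use subgroup.subset [OF A] m_comm in auto)
    obtain \<rho> where
      "\<And>B. subgroup B (G\<lparr>carrier := A\<rparr>) \<Longrightarrow> \<rho> B \<in> quints (sub_type (\<tau> A))"
      "\<And>B. subgroup B (G\<lparr>carrier := A\<rparr>) \<Longrightarrow> card B = p ^ sub_exp (\<rho> B)"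
      "\<And>B. subgroup B (G\<lparr>carrier := A\<rparr>) \<Longrightarrow> G\<lparr>carrier := A\<rparr> Mod B \<cong> ZP p (factor_type (\<rho> B))"
      "\<And>y. y \<in> quints (sub_type (\<tau> A)) \<Longrightarrow>
        card {B. subgroup B (G\<lparr>carrier := A\<rparr>) \<and> \<rho> B = y} = totient (p ^ mid y)"
      by (rule rank_two_subgroups [OF p cg \<tau>(3) [OF A]]) (rule that)
    then have "Q A \<rho>"
      unfolding Q_def by blast
    then show ?thesis
      by blast
  qed
  then obtain \<rho> where \<rho>: "\<And>A. subgroup A G \<Longrightarrow> Q A (\<rho> A)"
    by metis
  define \<sigma> where "\<sigma> = (\<lambda>(A, B). (\<tau> A, \<rho> A B))"
  have chains: "subgroup_chains G = (SIGMA A:{A. subgroup A G}. {B. subgroup B (G\<lparr>carrier := A\<rparr>)})"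
    by (auto simp: subgroup_chains_def subgroup_of_subgroup_iff)
  show thesis
  proof
    fix P assume "P \<in> subgroup_chains G"
    then obtain A B where P: "P = (A, B)" and A: "subgroup A G" and B: "subgroup B (G\<lparr>carrier := A\<rparr>)"
      by (auto simp: chains)
    have \<rho>AB: "\<rho> A B \<in> quints (sub_type (\<tau> A))" "card B = p ^ sub_exp (\<rho> A B)"
        "G\<lparr>carrier := A\<rparr> Mod B \<cong> ZP p (factor_type (\<rho> A B))"
      using \<rho> [OF A] B by (auto simp: Q_def)
    show "\<sigma> P \<in> quint_pairs t" "card (fst P) = p ^ sub_exp (fst (\<sigma> P))"
      "card (snd P) = p ^ sub_exp (snd (\<sigma> P))" "chain_quot G P \<cong> ZP p (factor_type (snd (\<sigma> P)))"
      using \<tau>(1,2) [OF A] \<rho>AB by (simp_all add: P \<sigma>_def quint_pairs_def chain_quot_def)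
  next
    fix w assume "w \<in> quint_pairs t"
    then obtain x y where w: "w = (x, y)" and x: "x \<in> quints t" and y: "y \<in> quints (sub_type x)"
      by (auto simp: quint_pairs_def)
    let ?A = "{A. subgroup A G \<and> \<tau> A = x}"
    have "{P \<in> subgroup_chains G. \<sigma> P = w} = (SIGMA A:?A. {B. subgroup B (G\<lparr>carrier := A\<rparr>) \<and> \<rho> A B = y})"
      by (auto simp: chains \<sigma>_def w)
    also have "card \<dots> = (\<Sum>A\<in>?A. card {B. subgroup B (G\<lparr>carrier := A\<rparr>) \<and> \<rho> A B = y})"
    proof (rule card_SigmaI)
      show "finite ?A"
        using finite_subgroups [OF fin] by simp
      show "\<forall>A\<in>?A. finite {B. subgroup B (G\<lparr>carrier := A\<rparr>) \<and> \<rho> A B = y}"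
        using finite_subgroups [OF fin] by (auto simp: subgroup_of_subgroup_iff)
    qed
    also have "\<dots> = (\<Sum>A\<in>?A. totient (p ^ mid y))"
      using \<rho> y by (intro sum.cong) (auto simp: Q_def)
    finally show "card {P \<in> subgroup_chains G. \<sigma> P = w} = totient (p ^ mid (fst w)) * totient (p ^ mid (snd w))"
      using \<tau>(5) [OF x] by (simp add: w)
  qed
qed

section \<open>Counting subgroups of a product of two rank two groups\<close>

lemma factor_type_le: "fst (factor_type x) \<le> snd (factor_type x)"
  by (cases x) (simp add: min_def max_def)

text \<open>Types are sorted pairs, so the two groups are isomorphic exactly when their types agree.
  In that case both may be replaced by the same standard group, whose automorphisms \<open>F\<close>
  counts.\<close>

lemma card_isos_ZP:
  assumes p: "prime p" and X: "group X" "X \<cong> ZP p (factor_type x)"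
    and Y: "group Y" "Y \<cong> ZP p (factor_type y)"
  shows "card (isos X Y) =
    (if factor_type x = factor_type y then F (p ^ fst (factor_type x)) (p ^ snd (factor_type x)) else 0)"
proof (cases "factor_type x = factor_type y")
  case True
  have "finite (carrier X)" "finite (carrier Y)"
    using iso_finite [OF X(2)] iso_finite [OF Y(2)] finite_ZP [OF p] by blast+
  then have "card (isos X Y) = card (isos (ZP p (factor_type x)) (ZP p (factor_type x)))"
    using X Y True by (intro card_isos_cong) (auto simp: group_ZP)
  then show ?thesis
    using True by (simp add: F_def auto_eq_isos ZP_def)
next
  case False
  have "\<not> X \<cong> Y"
  proof
    assume "X \<cong> Y"
    then have "ZP p (factor_type x) \<cong> ZP p (factor_type y)"
      by (rule iso_trans [OF group.iso_sym [OF X] iso_trans [OF _ Y(2)]])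
    then show False
      using ZP_iso_unique [OF p factor_type_le factor_type_le] False by blast
  qed
  then show ?thesis
    using isos_eq_empty [OF X(1) \<open>\<not> X \<cong> Y\<close>] False by simp
qed

text \<open>The sum is regrouped twice: subgroups by their Goursat data, then data by their labels.
  The summand depends on the labels alone.\<close>

lemma card_subgroups_rank_four:
  assumes p: "prime p"
  shows "card {K. subgroup K (ZP p s \<times>\<times> ZP p t) \<and> card K = p ^ k} =
    (\<Sum>(w, w') | w \<in> quint_pairs s \<and> w' \<in> quint_pairs t \<and>
        factor_type (snd w) = factor_type (snd w') \<and> sub_exp (fst w) + sub_exp (snd w') = k.
      totient (p ^ mid (fst w)) * totient (p ^ mid (snd w)) *
      totient (p ^ mid (fst w')) * totient (p ^ mid (snd w')) *
      F (p ^ fst (factor_type (snd w))) (p ^ snd (factor_type (snd w))))"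
proof -
  let ?G = "ZP p s" and ?H = "ZP p t"
  interpret two_comm_groups ?G ?H
    by (simp add: two_comm_groups_def comm_group_ZP)
  have fin: "finite (carrier ?G)" "finite (carrier ?H)"
    using finite_ZP [OF p] by blast+
  obtain \<sigma> where \<sigma>: "\<And>P. P \<in> subgroup_chains ?G \<Longrightarrow> \<sigma> P \<in> quint_pairs s"
    "\<And>P. P \<in> subgroup_chains ?G \<Longrightarrow> card (fst P) = p ^ sub_exp (fst (\<sigma> P))"
    "\<And>P. P \<in> subgroup_chains ?G \<Longrightarrow> card (snd P) = p ^ sub_exp (snd (\<sigma> P))"
    "\<And>P. P \<in> subgroup_chains ?G \<Longrightarrow> chain_quot ?G P \<cong> ZP p (factor_type (snd (\<sigma> P)))"
    "\<And>w. w \<in> quint_pairs s \<Longrightarrow> card {P \<in> subgroup_chains ?G. \<sigma> P = w} =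
      totient (p ^ mid (fst w)) * totient (p ^ mid (snd w))"
    by (rule rank_two_chains [OF p comm_group_ZP [of p s] iso_refl]) (rule that)
  obtain \<sigma>' where \<sigma>': "\<And>P. P \<in> subgroup_chains ?H \<Longrightarrow> \<sigma>' P \<in> quint_pairs t"
    "\<And>P. P \<in> subgroup_chains ?H \<Longrightarrow> card (fst P) = p ^ sub_exp (fst (\<sigma>' P))"
    "\<And>P. P \<in> subgroup_chains ?H \<Longrightarrow> card (snd P) = p ^ sub_exp (snd (\<sigma>' P))"
    "\<And>P. P \<in> subgroup_chains ?H \<Longrightarrow> chain_quot ?H P \<cong> ZP p (factor_type (snd (\<sigma>' P)))"
    "\<And>w. w \<in> quint_pairs t \<Longrightarrow> card {P \<in> subgroup_chains ?H. \<sigma>' P = w} =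
      totient (p ^ mid (fst w)) * totient (p ^ mid (snd w))"
    by (rule rank_two_chains [OF p comm_group_ZP [of p t] iso_refl]) (rule that)
  let ?S = "{K. subgroup K (?G \<times>\<times> ?H) \<and> card K = p ^ k}"
  let ?C = "subgroup_chains ?G \<times> subgroup_chains ?H"
  let ?W = "quint_pairs s \<times> quint_pairs t"
  \<comment> \<open>\<open>g\<close> is the number of subgroups of the required order with given
    Goursat data, expressed through the labels; it vanishes if the order is wrong or the quotients
    have different types.\<close>
  define g :: "(quint \<times> quint) \<times> (quint \<times> quint) \<Rightarrow> nat"
    where "g = (\<lambda>(w, w'). if factor_type (snd w) = factor_type (snd w') \<and>
      sub_exp (fst w) + sub_exp (snd w') = k
    then F (p ^ fst (factor_type (snd w))) (p ^ snd (factor_type (snd w))) else 0)"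
  define \<Sigma> where "\<Sigma> = (\<lambda>(P, Q). (\<sigma> P, \<sigma>' Q))"
  have finS: "finite ?S"
    using finite_subgroups [of "?G \<times>\<times> ?H"] fin by simp
  have finC: "finite ?C"
    using finite_chains fin by blast
  have "card ?S = (\<Sum>K\<in>?S. 1)" by simp
  also have "\<dots> = (\<Sum>c\<in>?C. \<Sum>K | K \<in> ?S \<and> goursat ?G ?H K = c. 1)"
    by (rule sum.group [symmetric, OF finS finC]) (use goursat_chains in blast)
  also have "\<dots> = (\<Sum>c\<in>?C. g (\<Sigma> c))"
  proof (rule sum.cong [OF refl])
    fix c assume "c \<in> ?C"
    then obtain A B C D where c: "c = ((A, B), (C, D))" and AB: "(A, B) \<in> subgroup_chains ?G"
      and CD: "(C, D) \<in> subgroup_chains ?H"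
      by auto
    \<comment> \<open>The order is constant on each class of subgroups with common data, so a class
      is counted entirely or not at all.\<close>
    have "card K = p ^ (sub_exp (fst (\<sigma> (A, B))) + sub_exp (snd (\<sigma>' (C, D))))"
      if "subgroup K (?G \<times>\<times> ?H)" "goursat ?G ?H K = c" for K
      using card_subgroup_prod [OF that(1) fin] that(2) \<sigma>(2) [OF AB] \<sigma>'(3) [OF CD]
      by (simp add: goursat_def c power_add)
    then have "{K \<in> ?S. goursat ?G ?H K = c} =
      (if sub_exp (fst (\<sigma> (A, B))) + sub_exp (snd (\<sigma>' (C, D))) = k
       then {K. subgroup K (?G \<times>\<times> ?H) \<and> goursat ?G ?H K = c} else {})"
      using prime_gt_1_nat [OF p] by auto
    then show "(\<Sum>K | K \<in> ?S \<and> goursat ?G ?H K = c. 1) = g (\<Sigma> c)"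
      using card_goursat_fiber [OF AB CD]
        card_isos_ZP [OF p _ \<sigma>(4) [OF AB] _ \<sigma>'(4) [OF CD]]
        G.chain_quot_facts(1) [OF AB] H.chain_quot_facts(1) [OF CD]
      by (simp add: c g_def \<Sigma>_def comm_group.axioms(2))
  qed
  also have "\<dots> = (\<Sum>w\<in>?W. \<Sum>c | c \<in> ?C \<and> \<Sigma> c = w. g (\<Sigma> c))"
    by (rule sum.group [symmetric, OF finC])
      (use \<sigma>(1) \<sigma>'(1) in \<open>auto simp: finite_quint_pairs \<Sigma>_def\<close>)
  also have "\<dots> = (\<Sum>w\<in>?W. card {c \<in> ?C. \<Sigma> c = w} * g w)"
    by (intro sum.cong) auto
  also have "\<dots> = (\<Sum>(w, w')\<in>?W. totient (p ^ mid (fst w)) * totient (p ^ mid (snd w)) *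
      (totient (p ^ mid (fst w')) * totient (p ^ mid (snd w'))) * g (w, w'))"
  proof (rule sum.cong [OF refl], clarify)
    fix x y z t' assume w: "(x, y) \<in> quint_pairs s" "(z, t') \<in> quint_pairs t"
    have "{c \<in> ?C. \<Sigma> c = ((x, y), (z, t'))} =
        {P \<in> subgroup_chains ?G. \<sigma> P = (x, y)} \<times> {P \<in> subgroup_chains ?H. \<sigma>' P = (z, t')}"
      by (auto simp: \<Sigma>_def)
    then show "card {c \<in> ?C. \<Sigma> c = ((x, y), (z, t'))} * g ((x, y), (z, t')) =
      totient (p ^ mid (fst (x, y))) * totient (p ^ mid (snd (x, y))) *
      (totient (p ^ mid (fst (z, t'))) * totient (p ^ mid (snd (z, t')))) * g ((x, y), (z, t'))"
      using \<sigma>(5) [OF w(1)] \<sigma>'(5) [OF w(2)] by (simp add: card_cartesian_product)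
  qed
  also have "\<dots> = (\<Sum>(w, w') | w \<in> quint_pairs s \<and> w' \<in> quint_pairs t \<and>
        factor_type (snd w) = factor_type (snd w') \<and> sub_exp (fst w) + sub_exp (snd w') = k.
      totient (p ^ mid (fst w)) * totient (p ^ mid (snd w)) *
      totient (p ^ mid (fst w')) * totient (p ^ mid (snd w')) *
      F (p ^ fst (factor_type (snd w))) (p ^ snd (factor_type (snd w))))"
    by (rule sum.mono_neutral_cong_right)
      (auto simp: finite_quint_pairs g_def simp del: factor_type.simps sub_exp.simps mid.simps
        split: if_splits)
  finally show ?thesis .
qed

text \<open>\<open>N\<close> uses a right-nested product of four factors, while Goursat's lemma is
  applied to two pairs; the bijection \<open>f\<close> only reassociates.\<close>

lemma N_eq_card:
  "N (p ^ a) (p ^ b) (p ^ c) (p ^ d) n = card {K. subgroup K (ZP p (a, b) \<times>\<times> ZP p (c, d)) \<and> card K = n}"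
proof -
  let ?G = "Z (p ^ a) \<times>\<times> Z (p ^ b) \<times>\<times> Z (p ^ c) \<times>\<times> Z (p ^ d)"
  let ?H = "ZP p (a, b) \<times>\<times> ZP p (c, d)"
  interpret G: group ?G by (simp add: DirProd_group)
  have H: "group ?H" by (simp add: DirProd_group group_ZP)
  define f :: "int \<times> int \<times> int \<times> int \<Rightarrow> (int \<times> int) \<times> (int \<times> int)"
    where "f = (\<lambda>(x, y, z). ((x, y), z))"
  have f: "f \<in> iso ?G ?H"
    by (rule group_isomorphisms_imp_iso [of _ _ f "\<lambda>((x, y), z). (x, y, z)"])
      (auto simp: group_isomorphisms_def f_def hom_def ZP_def)
  have "inj f" by (auto simp: f_def inj_on_def)
  have "bij_betw (image f) {K. subgroup K ?G \<and> card K = n} {K. subgroup K ?H \<and> card K = n}"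
  proof (rule bij_betw_subset [OF G.bij_betw_subgroups [OF f H]])
    show "image f ` {K. subgroup K ?G \<and> card K = n} = {K. subgroup K ?H \<and> card K = n}"
    proof (intro equalityI subsetI)
      fix L assume L: "L \<in> {K. subgroup K ?H \<and> card K = n}"
      then have "L \<in> image f ` {K. subgroup K ?G}"
        using bij_betw_imp_surj_on [OF G.bij_betw_subgroups [OF f H]] by simp
      then obtain K where "subgroup K ?G" "L = f ` K"
        by blast
      then show "L \<in> image f ` {K. subgroup K ?G \<and> card K = n}"
        using L \<open>inj f\<close> by (auto simp: card_image inj_on_subset)
    next
      fix L assume "L \<in> image f ` {K. subgroup K ?G \<and> card K = n}"
      then show "L \<in> {K. subgroup K ?H \<and> card K = n}"
        using \<open>inj f\<close> subgroup.iso_subgroup [OF _ G.group_axioms H f]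
        by (auto simp: card_image inj_on_subset)
    qed
  qed auto
  then show ?thesis
    by (simp add: N_def bij_betw_same_card)
qed

theorem corollary8:
  fixes p a b c d k :: nat
  assumes "prime p"
    and "k \<le> a + b + c + d"
  shows "N (p ^ a) (p ^ b) (p ^ c) (p ^ d) (p ^ k) =
    (\<Sum>(x1, x2, x3, x4, x5, y1, y2, y3, y4, y5, z1, z2, z3, z4, z5, t1, t2, t3, t4, t5) \<in>
        {(x1, x2, x3, x4, x5, y1, y2, y3, y4, y5, z1, z2, z3, z4, z5, t1, t2, t3, t4, t5).
           x1 + x2 + x3 = a \<and>
           x3 + x4 + x5 = b \<and>
           y1 + y2 + y3 = min x1 x4 \<and>
           y3 + y4 + y5 = x3 + max x1 x4 \<and>
           z1 + z2 + z3 = c \<and>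
           z3 + z4 + z5 = d \<and>
           t1 + t2 + t3 = min z1 z4 \<and>
           t3 + t4 + t5 = z3 + max z1 z4 \<and>
           min y2 y5 = min t2 t5 \<and>
           y3 + max y2 y5 = t3 + max t2 t5 \<and>
           x1 + x3 + x4 + t1 + t3 + t4 = k}.
        let u = min y2 y5; v = y3 + max y2 y5
        in totient (p ^ x3) * totient (p ^ y3) * totient (p ^ z3) * totient (p ^ t3) *
           F (p ^ u) (p ^ v))"
  \<comment> \<open>What remains is to flatten the four quintuples. Conditions (i) to (iv) and (v)
    to (viii) are membership in \<open>quint_pairs\<close> for the two sides, (ix) and (x) are
    equality of the factor types, and (xi) is the condition on the order.\<close>
  unfolding N_eq_card card_subgroups_rank_four [OF assms(1)]
  by (rule sum.reindex_bij_witness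
      [of _ "\<lambda>(x1, x2, x3, x4, x5, y1, y2, y3, y4, y5, z1, z2, z3, z4, z5, t1, t2, t3, t4, t5).
          (((x1, x2, x3, x4, x5), (y1, y2, y3, y4, y5)), ((z1, z2, z3, z4, z5), (t1, t2, t3, t4, t5)))"
        "\<lambda>(((x1, x2, x3, x4, x5), (y1, y2, y3, y4, y5)), ((z1, z2, z3, z4, z5), (t1, t2, t3, t4, t5))).
          (x1, x2, x3, x4, x5, y1, y2, y3, y4, y5, z1, z2, z3, z4, z5, t1, t2, t3, t4, t5)"])
    (auto simp only: split_paired_all quint_pairs_def quints_def Let_def mem_Collect_eq mem_Sigma_iff
      prod.case sub_type.simps factor_type.simps mid.simps sub_exp.simps fst_conv snd_conv prod.inject
      add.assoc)

end
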